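(* Let $r > 0$, $\Lambda := \{x \in \mathbb{R}^n : \|x\|_2 \le r\}$, and let $g_1, \dots, g_m \in \mathbb{R}[x]$. Suppose the set $X$ and the sequence $\{J_d^*\}_{d \in \mathbb{N}} \subset \mathbb{R}[x]$ satisfy either of the following: (i) $X = \{x \in \Lambda : g_i(x) < 0 \text{ for all } 1 \le i \le m\}$ and, for each $d \in \mathbb{N}$, $J_d^*$ is the $J$-component of an optimal solution $(J_d^*, P_d^*, \gamma_d^* )$ of the problem $(\mathrm{I}_d)$ defined in the context; (ii) $X = \bigcup_{i=1}^m \{x \in \Lambda : g_i(x) < 0\}$ and, for each $d \in \mathbb{N}$, $J_d^*$ is the $J$-component of an optimal solution $(J_d^*, P_d^*, \gamma_d^* )$ of the problem $(\mathrm{U}_d)$ defined in the context. Then $$\lim_{d \to \infty} D_H\big(\{x \in \Lambda : J_d^*(x) < 0\}, X\big) = 0 \qquad \text{and} \qquad \{x \in \Lambda : J_d^*(x) < 0\} \subseteq X.$$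
   Context: $\mathbb{R}[x]$ is the set of real polynomials in $x \in \mathbb{R}^n$ and $\mathbb{R}_d[x]$ those of degree at most $d$. A polynomial is Sum-of-Squares (SOS) if it is a finite sum of squares of polynomials; $\sum_{SOS}^d$ denotes the set of SOS polynomials of degree at most $d$. Hausdorff metric: for $A, B \subset \mathbb{R}^n$, $D_H(A,B) := \max\{H(A,B), H(B,A)\}$, where $H(A,B) := \sup_{x \in A} \inf_{y \in B} \|x-y\|_2$. Convention: infima and suprema are taken in $[0,\infty]$, so $\inf\emptyset = +\infty$, $\sup\emptyset = 0$. Problem $(\mathrm{I}_d)$ (degree $d$): minimize $\gamma$ over $J \in \mathbb{R}_d[x]$, $P \in \mathbb{R}_d[x]$, $\gamma \in \mathbb{R}$ for which there exist $s_{i,1}, s_{i,j,2}, s_{i,3}, s_4 \in \sum_{SOS}^d$ ($i,j \in \{1,\dots,m\}$) such that - $(g_i(x) - P(x)) - s_{i,1}(x)(r^2 - \|x\|_2^2) - \sum_{j=1}^m s_{i,j,2}(x)(g_i(x) - g_j(x)) \in \sum_{SOS}^d$ for all $1 \le i \le m$, - $J(x) - g_i(x) - s_{i,3}(x)(r^2 - \|x\|_2^2) \in \sum_{SOS}^d$ for all $1 \le i \le m$, - $\gamma - (J(x) - P(x)) - s_4(x)(r^2 - \|x\|_2^2) \in \sum_{SOS}^d$. Problem $(\mathrm{U}_d)$ (degree $d$): minimize $\gamma$ over $J \in \mathbb{R}_d[x]$, $P \in \mathbb{R}_d[x]$, $\gamma \in \mathbb{R}$ for which there exist $s_{i,1},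 s_{i,2}, s_{i,j,3}, s_4 \in \sum_{SOS}^d$ ($i,j \in \{1,\dots,m\}$) such that - $(g_i(x) - P(x)) - s_{i,1}(x)(r^2 - \|x\|_2^2) \in \sum_{SOS}^d$ for all $1 \le i \le m$, - $(J(x) - g_i(x)) - s_{i,2}(x)(r^2 - \|x\|_2^2) - \sum_{j=1}^m s_{i,j,3}(x)(g_j(x) - g_i(x)) \in \sum_{SOS}^d$ for all $1 \le i \le m$, - $\gamma - (J(x) - P(x)) - s_4(x)(r^2 - \|x\|_2^2) \in \sum_{SOS}^d$. *)

theory Defs
  imports "HOL-Analysis.Analysis"
begin

text \<open>
  Polynomials in \<open>n = CARD('n)\<close> real variables are represented by their polynomial functions
  on \<open>real ^ 'n\<close>; since the reals are infinite, this loses no information. The ring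
  $\mathbb{R}[x]$ is \<^const>\<open>real_polynomial_function\<close>. For $\mathbb{R}_d[x]$ the total degree is
  bounded explicitly, a multi-index being a function \<open>'n \<Rightarrow> nat\<close>; the lemma
  \<open>real_polynomial_function_iff_poly_upto\<close> below relates the two.
\<close>

definition monomial_fun :: "('n::finite \<Rightarrow> nat) \<Rightarrow> real ^ 'n \<Rightarrow> real" where
  "monomial_fun \<alpha> x = (\<Prod>i\<in>UNIV. (x $ i) ^ \<alpha> i)"

definition multi_indices :: "nat \<Rightarrow> ('n::finite \<Rightarrow> nat) set" where
  "multi_indices d = {\<alpha>. (\<Sum>i\<in>UNIV. \<alpha> i) \<le> d}"

definition poly_upto :: "nat \<Rightarrow> (real ^ 'n::finite \<Rightarrow> real) set" where
  "poly_upto d = {p. \<exists>c. p = (\<lambda>x. \<Sum>\<alpha>\<in>multi_indices d. c \<alpha> * monomial_fun \<alpha> x)}"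

definition is_sos :: "(real ^ 'n::finite \<Rightarrow> real) \<Rightarrow> bool" where
  "is_sos p \<longleftrightarrow> (\<exists>N q. (\<forall>k<N. real_polynomial_function (q k)) \<and>
                       p = (\<lambda>x. \<Sum>k<(N::nat). (q k x)\<^sup>2))"

definition sos_upto :: "nat \<Rightarrow> (real ^ 'n::finite \<Rightarrow> real) set" where
  "sos_upto d = {p \<in> poly_upto d. is_sos p}"

text \<open>
  Distances are taken in \<^typ>\<open>ennreal\<close>, where the infimum over the empty set is \<open>\<infinity>\<close> and the
  supremum over the empty set is \<open>0\<close>.
\<close>

definition hausdorff_excess :: "(real ^ 'n::finite) set \<Rightarrow> (real ^ 'n) set \<Rightarrow> ennreal" where
  "hausdorff_excess A B = (SUP x\<in>A. INF y\<in>B. ennreal (norm (x - y)))"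

definition hausdorff_distance :: "(real ^ 'n::finite) set \<Rightarrow> (real ^ 'n) set \<Rightarrow> ennreal" where
  "hausdorff_distance A B = max (hausdorff_excess A B) (hausdorff_excess B A)"

text \<open>
  The two optimization problems of degree \<open>d\<close>; the multiplier certificates are existentially
  quantified in the feasibility predicate, and the decision variables are \<open>J\<close>, \<open>P\<close>, \<open>\<gamma>\<close>. The
  degree bound \<open>d\<close> applies to each multiplier and to each left-hand side as a whole, not to the
  individual products inside it.
\<close>

definition feasible_I ::
  "nat \<Rightarrow> real \<Rightarrow> nat \<Rightarrow> (nat \<Rightarrow> real ^ 'n::finite \<Rightarrow> real) \<Rightarrow>
   (real ^ 'n \<Rightarrow> real) \<Rightarrow> (real ^ 'n \<Rightarrow> real) \<Rightarrow> real \<Rightarrow> bool" where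
  "feasible_I d r m g J P \<gamma> \<longleftrightarrow>
     J \<in> poly_upto d \<and> P \<in> poly_upto d \<and>
     (\<exists>s1 s2 s3 s4.
        (\<forall>i\<in>{1..m}. s1 i \<in> sos_upto d) \<and>
        (\<forall>i\<in>{1..m}. \<forall>j\<in>{1..m}. s2 i j \<in> sos_upto d) \<and>
        (\<forall>i\<in>{1..m}. s3 i \<in> sos_upto d) \<and>
        s4 \<in> sos_upto d \<and>
        (\<forall>i\<in>{1..m}.
           (\<lambda>x. (g i x - P x) - s1 i x * (r\<^sup>2 - (norm x)\<^sup>2)
                - (\<Sum>j=1..m. s2 i j x * (g i x - g j x))) \<in> sos_upto d) \<and>
        (\<forall>i\<in>{1..m}.
           (\<lambda>x. J x - g i x - s3 i x * (r\<^sup>2 - (norm x)\<^sup>2)) \<in> sos_upto d) \<and>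
        (\<lambda>x. \<gamma> - (J x - P x) - s4 x * (r\<^sup>2 - (norm x)\<^sup>2)) \<in> sos_upto d)"

definition feasible_U ::
  "nat \<Rightarrow> real \<Rightarrow> nat \<Rightarrow> (nat \<Rightarrow> real ^ 'n::finite \<Rightarrow> real) \<Rightarrow>
   (real ^ 'n \<Rightarrow> real) \<Rightarrow> (real ^ 'n \<Rightarrow> real) \<Rightarrow> real \<Rightarrow> bool" where
  "feasible_U d r m g J P \<gamma> \<longleftrightarrow>
     J \<in> poly_upto d \<and> P \<in> poly_upto d \<and>
     (\<exists>s1 s2 s3 s4.
        (\<forall>i\<in>{1..m}. s1 i \<in> sos_upto d) \<and>
        (\<forall>i\<in>{1..m}. s2 i \<in> sos_upto d) \<and>
        (\<forall>i\<in>{1..m}. \<forall>j\<in>{1..m}. s3 i j \<in> sos_upto d) \<and>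
        s4 \<in> sos_upto d \<and>
        (\<forall>i\<in>{1..m}.
           (\<lambda>x. (g i x - P x) - s1 i x * (r\<^sup>2 - (norm x)\<^sup>2)) \<in> sos_upto d) \<and>
        (\<forall>i\<in>{1..m}.
           (\<lambda>x. (J x - g i x) - s2 i x * (r\<^sup>2 - (norm x)\<^sup>2)
                - (\<Sum>j=1..m. s3 i j x * (g j x - g i x))) \<in> sos_upto d) \<and>
        (\<lambda>x. \<gamma> - (J x - P x) - s4 x * (r\<^sup>2 - (norm x)\<^sup>2)) \<in> sos_upto d)"

definition optimal_I ::
  "nat \<Rightarrow> real \<Rightarrow> nat \<Rightarrow> (nat \<Rightarrow> real ^ 'n::finite \<Rightarrow> real) \<Rightarrow>
   (real ^ 'n \<Rightarrow> real) \<Rightarrow> (real ^ 'n \<Rightarrow> real) \<Rightarrow> real \<Rightarrow> bool" where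
  "optimal_I d r m g J P \<gamma> \<longleftrightarrow>
     feasible_I d r m g J P \<gamma> \<and>
     (\<forall>J' P' \<gamma>'. feasible_I d r m g J' P' \<gamma>' \<longrightarrow> \<gamma> \<le> \<gamma>')"

definition optimal_U ::
  "nat \<Rightarrow> real \<Rightarrow> nat \<Rightarrow> (nat \<Rightarrow> real ^ 'n::finite \<Rightarrow> real) \<Rightarrow>
   (real ^ 'n \<Rightarrow> real) \<Rightarrow> (real ^ 'n \<Rightarrow> real) \<Rightarrow> real \<Rightarrow> bool" where
  "optimal_U d r m g J P \<gamma> \<longleftrightarrow>
     feasible_U d r m g J P \<gamma> \<and>
     (\<forall>J' P' \<gamma>'. feasible_U d r m g J' P' \<gamma>' \<longrightarrow> \<gamma> \<le> \<gamma>')"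

lemma finite_multi_indices: "finite (multi_indices d :: ('n::finite \<Rightarrow> nat) set)"
proof (rule finite_subset)
  show "multi_indices d \<subseteq> PiE (UNIV :: 'n set) (\<lambda>_. {..d})"
  proof
    fix \<alpha> :: "'n \<Rightarrow> nat" assume "\<alpha> \<in> multi_indices d"
    then have le: "(\<Sum>i\<in>UNIV. \<alpha> i) \<le> d" by (simp add: multi_indices_def)
    have "\<alpha> i \<le> d" for i
      using member_le_sum[of i UNIV \<alpha>] le by simp
    then show "\<alpha> \<in> PiE UNIV (\<lambda>_. {..d})" by auto
  qed
  show "finite (PiE (UNIV :: 'n set) (\<lambda>_. {..d}))"
    by (rule finite_PiE) auto
qed

lemma poly_uptoI:
  "(\<And>x. p x = (\<Sum>\<alpha>\<in>multi_indices d. c \<alpha> * monomial_fun \<alpha> x)) \<Longrightarrow> p \<in> poly_upto d"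
  unfolding poly_upto_def by (intro CollectI exI[of _ c] ext)

lemma poly_upto_add:
  assumes "p \<in> poly_upto d" "q \<in> poly_upto d"
  shows "(\<lambda>x. p x + q x) \<in> poly_upto d"
proof -
  obtain a b where "p = (\<lambda>x. \<Sum>\<alpha>\<in>multi_indices d. a \<alpha> * monomial_fun \<alpha> x)"
    and "q = (\<lambda>x. \<Sum>\<alpha>\<in>multi_indices d. b \<alpha> * monomial_fun \<alpha> x)"
    using assms unfolding poly_upto_def by blast
  then show ?thesis
    by (intro poly_uptoI[where c = "\<lambda>\<alpha>. a \<alpha> + b \<alpha>"]) (simp add: sum.distrib distrib_right)
qed

lemma poly_upto_monomial:
  assumes "\<alpha> \<in> multi_indices d"
  shows "(\<lambda>x. c * monomial_fun \<alpha> x) \<in> poly_upto d"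
proof (rule poly_uptoI)
  fix x
  have "(\<Sum>\<beta>\<in>multi_indices d. (if \<beta> = \<alpha> then c else 0) * monomial_fun \<beta> x) =
        (\<Sum>\<beta>\<in>multi_indices d. if \<beta> = \<alpha> then c * monomial_fun \<beta> x else 0)"
    by (intro sum.cong) auto
  then show "c * monomial_fun \<alpha> x =
        (\<Sum>\<beta>\<in>multi_indices d. (if \<beta> = \<alpha> then c else 0) * monomial_fun \<beta> x)"
    using assms by (simp add: sum.delta[OF finite_multi_indices])
qed

lemma poly_upto_sum:
  assumes "finite I" "\<And>i. i \<in> I \<Longrightarrow> p i \<in> poly_upto d"
  shows "(\<lambda>x. \<Sum>i\<in>I. p i x) \<in> poly_upto d"
  using assms
proof (induction I rule: finite_induct)
  case empty
  have "(\<lambda>x. 0 * monomial_fun (\<lambda>_. 0) x) \<in> poly_upto d"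
    by (rule poly_upto_monomial) (simp add: multi_indices_def)
  then show ?case by simp
next
  case (insert i I)
  then show ?case by (simp add: poly_upto_add)
qed

lemma poly_upto_mono:
  assumes "d \<le> e" "p \<in> poly_upto d"
  shows "p \<in> poly_upto e"
proof -
  obtain a where p: "p = (\<lambda>x. \<Sum>\<alpha>\<in>multi_indices d. a \<alpha> * monomial_fun \<alpha> x)"
    using assms unfolding poly_upto_def by blast
  have "(\<lambda>x. \<Sum>\<alpha>\<in>multi_indices d. a \<alpha> * monomial_fun \<alpha> x) \<in> poly_upto e"
    by (rule poly_upto_sum[OF finite_multi_indices], rule poly_upto_monomial)
       (use assms(1) in \<open>simp add: multi_indices_def\<close>)
  then show ?thesis using p by simp
qed

lemma poly_upto_mult:
  assumes "p \<in> poly_upto d" "q \<in> poly_upto e"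
  shows "(\<lambda>x. p x * q x) \<in> poly_upto (d + e)"
proof -
  obtain a b where pq: "p = (\<lambda>x. \<Sum>\<alpha>\<in>multi_indices d. a \<alpha> * monomial_fun \<alpha> x)"
    "q = (\<lambda>x. \<Sum>\<beta>\<in>multi_indices e. b \<beta> * monomial_fun \<beta> x)"
    using assms unfolding poly_upto_def by blast
  have eq: "(\<lambda>x. p x * q x) = (\<lambda>x. \<Sum>\<alpha>\<in>multi_indices d. \<Sum>\<beta>\<in>multi_indices e.
      (a \<alpha> * b \<beta>) * monomial_fun (\<lambda>i. \<alpha> i + \<beta> i) x)"
    by (simp add: pq sum_product monomial_fun_def power_add prod.distrib mult_ac)
  show ?thesis
    unfolding eq
    by (rule poly_upto_sum[OF finite_multi_indices], rule poly_upto_sum[OF finite_multi_indices],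
        rule poly_upto_monomial) (simp add: multi_indices_def sum.distrib add_mono)
qed

lemma poly_upto_const: "(\<lambda>x. c) \<in> poly_upto d"
proof -
  have "(\<lambda>x. c * monomial_fun (\<lambda>_. 0) x) \<in> poly_upto d"
    by (rule poly_upto_monomial) (simp add: multi_indices_def)
  then show ?thesis by (simp add: monomial_fun_def)
qed

lemma poly_upto_component: "(\<lambda>x. c * x $ i) \<in> poly_upto 1"
proof -
  let ?\<alpha> = "\<lambda>j. if j = i then 1 else 0 :: nat"
  have "(\<lambda>x. c * monomial_fun ?\<alpha> x) \<in> poly_upto 1"
    by (rule poly_upto_monomial) (simp add: multi_indices_def)
  moreover have "monomial_fun ?\<alpha> x = x $ i" for x
    by (simp add: monomial_fun_def if_distrib[of "\<lambda>k. _ ^ k"] cong: if_cong)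
  ultimately show ?thesis by simp
qed

lemma real_polynomial_function_iff_poly_upto:
  "real_polynomial_function p \<longleftrightarrow> (\<exists>d. p \<in> poly_upto d)"
proof
  assume "real_polynomial_function p"
  then show "\<exists>d. p \<in> poly_upto d"
  proof (induction rule: real_polynomial_function.induct)
    case (linear f)
    then interpret f: bounded_linear f .
    have "f x = (\<Sum>i\<in>UNIV. f (axis i 1) * x $ i)" for x
    proof -
      have "x = (\<Sum>i\<in>UNIV. (x $ i) *\<^sub>R axis i 1)"
        using basis_expansion[of x] by (simp add: scalar_mult_eq_scaleR)
      then have "f x = f (\<Sum>i\<in>UNIV. (x $ i) *\<^sub>R axis i 1)" by (rule arg_cong)
      then show ?thesis by (simp add: f.sum f.scaleR mult.commute)
    qed
    then have "f = (\<lambda>x. \<Sum>i\<in>UNIV. f (axis i 1) * x $ i)" by (rule ext)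
    moreover have "(\<lambda>x. \<Sum>i\<in>UNIV. f (axis i 1) * x $ i) \<in> poly_upto 1"
      by (rule poly_upto_sum) (simp_all only: finite poly_upto_component)
    ultimately have "f \<in> poly_upto 1" by (rule ssubst[where P = "\<lambda>h. h \<in> poly_upto 1"])
    then show ?case by (rule exI)
  next
    case (const c)
    show ?case using poly_upto_const by blast
  next
    case (add f g)
    then obtain d e where "f \<in> poly_upto d" "g \<in> poly_upto e" by blast
    then have "f \<in> poly_upto (max d e)" "g \<in> poly_upto (max d e)"
      by (auto intro: poly_upto_mono[rotated])
    then show ?case using poly_upto_add by blast
  next
    case (mult f g)
    then show ?case using poly_upto_mult by blast
  qed
next
  assume "\<exists>d. p \<in> poly_upto d"
  then obtain d a where p: "p = (\<lambda>x. \<Sum>\<alpha>\<in>multi_indices d. a \<alpha> * monomial_fun \<alpha> x)"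
    unfolding poly_upto_def by blast
  have comp: "real_polynomial_function (\<lambda>x. (x $ i) ^ k)" for i :: 'a and k
    by (intro real_polynomial_function_power real_polynomial_function.intros(1) bounded_linear_vec_nth)
  have "real_polynomial_function (monomial_fun \<alpha>)" for \<alpha> :: "'a \<Rightarrow> nat"
    unfolding monomial_fun_def
    by (rule real_polynomial_function_prod) (simp_all add: comp)
  then show "real_polynomial_function p"
    unfolding p
    by (intro real_polynomial_function_sum finite_multi_indices
        real_polynomial_function.intros(4) real_polynomial_function.intros(2))
qed

end

theory Submission
  imports Defs
begin

text \<open>
  Replacing \<open>(g, J, P)\<close> by \<open>(-g, -P, -J)\<close> turns problem U into problem I, so only problem I
  matters. A feasible triple satisfies \<open>P \<le> V \<le> J\<close> and \<open>J - P \<le> \<gamma>\<close> on the ball, where \<open>V\<close> is the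
  pointwise maximum of the \<open>g i\<close>. Hence the inclusion is immediate, and the convergence follows from
  \<open>\<gamma> \<rightarrow> 0\<close>: every point of \<open>X\<close> eventually lies in the sublevel sets, and \<open>X\<close> is totally bounded.

  For \<open>\<gamma> \<rightarrow> 0\<close>, take polynomials \<open>J\<close> and \<open>P\<close> uniformly close to \<open>V\<close>, strictly above and below it.
  The certificates exist because a polynomial that is positive on the ball belongs to the preorder
  generated by \<open>r\<^sup>2 - |x|\<^sup>2\<close>. To see this, subtract \<open>q\<^sup>2 (r\<^sup>2 - |x|\<^sup>2)\<close> for a suitable \<open>q\<close> to make the
  polynomial positive on the enclosing cube; there it has nonnegative coefficients in a tensor
  Bernstein basis of high degree, and the factors \<open>r \<plusminus> x $ i\<close> of the basis lie in the preorder.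
\<close>

subsection \<open>Sums of squares and the preorder of the ball\<close>

lemma is_sos_real_polynomial_function: "is_sos p \<Longrightarrow> real_polynomial_function p"
  unfolding is_sos_def by (auto intro!: real_polynomial_function_sum)

lemma is_sos_nonneg: "is_sos p \<Longrightarrow> 0 \<le> p x"
  unfolding is_sos_def by (auto intro!: sum_nonneg)

lemma is_sos_zero: "is_sos (\<lambda>_. 0)"
  unfolding is_sos_def by (auto intro!: exI[of _ "0::nat"])

lemma is_sos_add_square:
  assumes "is_sos p" "real_polynomial_function q"
  shows "is_sos (\<lambda>x. p x + (q x)\<^sup>2)"
proof -
  obtain N u where "\<forall>k<N. real_polynomial_function (u k)" "p = (\<lambda>x. \<Sum>k<(N::nat). (u k x)\<^sup>2)"
    using assms(1) unfolding is_sos_def by blast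
  then show ?thesis
    using assms(2) unfolding is_sos_def
    by (intro exI[of _ "Suc N"] exI[of _ "u(N := q)"]) (auto simp: less_Suc_eq)
qed

lemma is_sos_square: "real_polynomial_function q \<Longrightarrow> is_sos (\<lambda>x. (q x)\<^sup>2)"
  using is_sos_add_square[OF is_sos_zero] by simp

text \<open>Building a sum one square at a time lets the closure properties be proved without
  reindexing double sums.\<close>

lemma is_sos_induct [consumes 1, case_names zero add_square]:
  assumes "is_sos p" and "P (\<lambda>_. 0)"
    and "\<And>p q. is_sos p \<Longrightarrow> P p \<Longrightarrow> real_polynomial_function q \<Longrightarrow> P (\<lambda>x. p x + (q x)\<^sup>2)"
  shows "P p"
proof -
  obtain N u where u: "\<forall>k<N. real_polynomial_function (u k)"
    and p: "p = (\<lambda>x. \<Sum>k<(N::nat). (u k x)\<^sup>2)"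
    using assms(1) unfolding is_sos_def by blast
  have "k \<le> N \<Longrightarrow> is_sos (\<lambda>x. \<Sum>k<k. (u k x)\<^sup>2) \<and> P (\<lambda>x. \<Sum>k<k. (u k x)\<^sup>2)" for k
    by (induction k) (use u in \<open>auto simp: is_sos_zero assms(2) intro!: is_sos_add_square assms(3)\<close>)
  then show ?thesis using p by blast
qed

lemma is_sos_add:
  assumes "is_sos p" "is_sos q"
  shows "is_sos (\<lambda>x. p x + q x)"
  using assms(2)
proof (induction rule: is_sos_induct)
  case (add_square q u)
  then show ?case
    using is_sos_add_square[of "\<lambda>x. p x + q x" u] by (simp add: add.assoc)
qed (simp add: assms(1))

lemma is_sos_mult:
  assumes "is_sos p" "is_sos q"
  shows "is_sos (\<lambda>x. p x * q x)"
  using assms(2)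
proof (induction rule: is_sos_induct)
  case (add_square q u)
  have "is_sos (\<lambda>x. p x * (u x)\<^sup>2)"
    using assms(1)
  proof (induction rule: is_sos_induct)
    case (add_square p v)
    then show ?case
      using is_sos_add_square[of "\<lambda>x. p x * (u x)\<^sup>2" "\<lambda>x. v x * u x"]
        \<open>real_polynomial_function u\<close>
      by (simp add: distrib_right power_mult_distrib real_polynomial_function.intros)
  qed (simp add: is_sos_zero)
  then show ?case
    using add_square is_sos_add by (simp add: distrib_left)
qed (simp add: is_sos_zero)

lemma is_sos_const: "0 \<le> c \<Longrightarrow> is_sos (\<lambda>_. c)"
  using is_sos_square[OF real_polynomial_function.intros(2), of "sqrt c"] by simp

lemma is_sos_sum: "(\<And>i. i \<in> I \<Longrightarrow> is_sos (p i)) \<Longrightarrow> is_sos (\<lambda>x. \<Sum>i\<in>I. p i x)"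
  by (induction I rule: infinite_finite_induct) (auto simp: is_sos_zero is_sos_add)

text \<open>Certificates are built as fixed polynomials, and finitely many of them meet the degree
  bound together once \<open>d\<close> is large. No explicit degrees need to be tracked.\<close>

lemma eventually_poly_upto:
  assumes "real_polynomial_function p"
  shows "\<forall>\<^sub>F d in sequentially. p \<in> poly_upto d"
  using assms poly_upto_mono unfolding real_polynomial_function_iff_poly_upto eventually_sequentially
  by blast

lemma eventually_sos_upto: "is_sos p \<Longrightarrow> \<forall>\<^sub>F d in sequentially. p \<in> sos_upto d"
  using eventually_poly_upto[OF is_sos_real_polynomial_function] by (simp add: sos_upto_def)

text \<open>There is a single generator \<open>h = r^2 - |x|^2\<close>, whose even powers are
  squares. So two summands suffice, and the quadratic module of \<open>h\<close> is already the
  preorder.\<close>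

definition ball_preorder :: "real \<Rightarrow> (real ^ 'n::finite \<Rightarrow> real) set" where
  "ball_preorder r =
     {p. \<exists>s t. is_sos s \<and> is_sos t \<and> p = (\<lambda>x. s x + t x * (r\<^sup>2 - (norm x)\<^sup>2))}"

lemma ball_preorderI:
  "is_sos s \<Longrightarrow> is_sos t \<Longrightarrow> (\<And>x. p x = s x + t x * (r\<^sup>2 - (norm x)\<^sup>2)) \<Longrightarrow> p \<in> ball_preorder r"
  unfolding ball_preorder_def by blast

lemma ball_preorderE:
  assumes "p \<in> ball_preorder r"
  obtains s t where "is_sos s" "is_sos t" "\<And>x. p x = s x + t x * (r\<^sup>2 - (norm x)\<^sup>2)"
  using assms unfolding ball_preorder_def by blast

lemma norm_sq_vec: "(norm x)\<^sup>2 = (\<Sum>i\<in>UNIV. (x $ i)\<^sup>2)" for x :: "real ^ 'n::finite"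
  by (simp add: norm_vec_def L2_set_def sum_nonneg)

lemma real_polynomial_function_component:
  "real_polynomial_function (\<lambda>x :: real ^ 'n::finite. x $ i)"
  by (intro real_polynomial_function.intros(1) bounded_linear_vec_nth)

lemma real_polynomial_function_ball:
  "real_polynomial_function (\<lambda>x :: real ^ 'n::finite. r\<^sup>2 - (norm x)\<^sup>2)"
  unfolding norm_sq_vec
  by (intro real_polynomial_function_diff real_polynomial_function_sum
      real_polynomial_function_power real_polynomial_function_component
      real_polynomial_function.intros(2)) auto

lemma ball_preorder_sos: "is_sos p \<Longrightarrow> p \<in> ball_preorder r"
  by (rule ball_preorderI[OF _ is_sos_zero]) auto

lemma ball_preorder_add:
  assumes "p \<in> ball_preorder r" "q \<in> ball_preorder r"
  shows "(\<lambda>x. p x + q x) \<in> ball_preorder r"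
proof -
  obtain s t where st: "is_sos s" "is_sos t" "\<And>x. p x = s x + t x * (r\<^sup>2 - (norm x)\<^sup>2)"
    using assms(1) by (rule ball_preorderE) blast
  obtain u v where uv: "is_sos u" "is_sos v" "\<And>x. q x = u x + v x * (r\<^sup>2 - (norm x)\<^sup>2)"
    using assms(2) by (rule ball_preorderE) blast
  show ?thesis
    by (rule ball_preorderI[OF is_sos_add[OF st(1) uv(1)] is_sos_add[OF st(2) uv(2)]])
      (simp add: st(3) uv(3) distrib_right)
qed

text \<open>The term \<open>t * v * h^2\<close> is a sum of squares and joins \<open>s * u\<close>;
  the cross terms form the new multiplier of \<open>h\<close>.\<close>

lemma ball_preorder_mult:
  assumes "p \<in> ball_preorder r" "q \<in> ball_preorder r"
  shows "(\<lambda>x. p x * q x) \<in> ball_preorder r"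
proof -
  let ?h = "\<lambda>x. r\<^sup>2 - (norm x)\<^sup>2"
  obtain s t where st: "is_sos s" "is_sos t" "\<And>x. p x = s x + t x * ?h x"
    using assms(1) by (rule ball_preorderE) blast
  obtain u v where uv: "is_sos u" "is_sos v" "\<And>x. q x = u x + v x * ?h x"
    using assms(2) by (rule ball_preorderE) blast
  show ?thesis
  proof (rule ball_preorderI)
    show "is_sos (\<lambda>x. s x * u x + (t x * v x) * (?h x)\<^sup>2)"
      using st uv by (intro is_sos_add is_sos_mult is_sos_square real_polynomial_function_ball)
    show "is_sos (\<lambda>x. s x * v x + t x * u x)"
      using st uv by (intro is_sos_add is_sos_mult)
  qed (simp add: st uv algebra_simps power2_eq_square)
qed

lemma ball_preorder_sum:
  "(\<And>i. i \<in> I \<Longrightarrow> p i \<in> ball_preorder r) \<Longrightarrow> (\<lambda>x. \<Sum>i\<in>I. p i x) \<in> ball_preorder r"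
  by (induction I rule: infinite_finite_induct)
    (auto simp: ball_preorder_sos is_sos_zero ball_preorder_add)

lemma ball_preorder_const: "0 \<le> c \<Longrightarrow> (\<lambda>_. c) \<in> ball_preorder r"
  by (intro ball_preorder_sos is_sos_const)

lemma ball_preorder_prod:
  "(\<And>i. i \<in> I \<Longrightarrow> p i \<in> ball_preorder r) \<Longrightarrow> (\<lambda>x. \<Prod>i\<in>I. p i x) \<in> ball_preorder r"
  by (induction I rule: infinite_finite_induct)
    (auto simp: ball_preorder_const ball_preorder_mult)

lemma ball_preorder_power: "p \<in> ball_preorder r \<Longrightarrow> (\<lambda>x. p x ^ k) \<in> ball_preorder r"
  by (induction k) (auto simp: ball_preorder_const ball_preorder_mult)

text \<open>Divide \<open>2 * r * (r + c * x $ i) = (x $ i + c * r)^2 + (sum of the other squared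
  coordinates) + (r^2 - |x|^2)\<close> by \<open>2 * r\<close>. The condition on \<open>c\<close>
  treats both signs, hence both faces of the cube, at once.\<close>

lemma ball_preorder_component:
  fixes i :: "'n::finite"
  assumes "r > 0" and c: "c\<^sup>2 = 1"
  shows "(\<lambda>x. r + c * x $ i) \<in> ball_preorder r"
proof (rule ball_preorderI)
  let ?s = "\<lambda>x. 1 / (2 * r) * ((x $ i + c * r)\<^sup>2 + (\<Sum>j\<in>UNIV - {i}. (x $ j)\<^sup>2))"
  show "is_sos ?s"
    using assms(1)
    by (intro is_sos_mult is_sos_const is_sos_add is_sos_square is_sos_sum
        real_polynomial_function_component real_polynomial_function.intros(2-4)) auto
  show "is_sos (\<lambda>_::real ^ 'n. 1 / (2 * r))"
    using assms(1) by (intro is_sos_const) simp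
  fix x :: "real ^ 'n"
  have "(norm x)\<^sup>2 = (x $ i)\<^sup>2 + (\<Sum>j\<in>UNIV - {i}. (x $ j)\<^sup>2)"
    unfolding norm_sq_vec by (rule sum.remove) auto
  moreover have "(x $ i + c * r)\<^sup>2 = (x $ i)\<^sup>2 + 2 * c * r * x $ i + r\<^sup>2"
    using c by (simp add: power2_sum power_mult_distrib algebra_simps)
  ultimately have "2 * r * (r + c * x $ i) =
      ((x $ i + c * r)\<^sup>2 + (\<Sum>j\<in>UNIV - {i}. (x $ j)\<^sup>2)) + (r\<^sup>2 - (norm x)\<^sup>2)"
    by (simp add: algebra_simps power2_eq_square)
  then show "r + c * x $ i = ?s x + 1 / (2 * r) * (r\<^sup>2 - (norm x)\<^sup>2)"
    using assms(1) by (simp add: nonzero_eq_divide_eq mult.commute flip: add_divide_distrib)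
qed

subsection \<open>Positivity on a cube and on a ball\<close>

text \<open>Multiply the partition of unity of degree \<open>N - j\<close> by \<open>x ^ j\<close>:
  each product is a multiple of the basis polynomial of degree \<open>N\<close> with index shifted
  by \<open>j\<close>. The terms with \<open>k < j\<close> vanish.\<close>

lemma power_eq_sum_Bernstein:
  assumes "j \<le> N"
  shows "x ^ j = (\<Sum>k\<le>N. real (k choose j) / real (N choose j) * Bernstein N k x)"
proof -
  let ?a = "\<lambda>k. real (k choose j) / real (N choose j) * Bernstein N k x"
  have shift: "?a (k + j) = x ^ j * Bernstein (N - j) k x" if "k \<le> N - j" for k
  proof -
    have "(N choose (k + j)) * ((k + j) choose j) = (N choose j) * ((N - j) choose k)"
      using choose_mult[of j "k + j" N] that assms by simp
    then have "real (N choose (k + j)) * real ((k + j) choose j) =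
        real (N choose j) * real ((N - j) choose k)"
      by (metis of_nat_mult)
    moreover have "real (N choose j) \<noteq> 0"
      using assms by simp
    moreover have "N - (k + j) = N - j - k"
      by simp
    ultimately show ?thesis
      by (simp add: Bernstein_def power_add divide_simps mult.commute)
  qed
  have "(\<Sum>k\<le>N. ?a k) = (\<Sum>k\<in>{0 + j..N - j + j}. ?a k)"
    using assms by (intro sum.mono_neutral_right) (auto simp: binomial_eq_0)
  also have "\<dots> = (\<Sum>k\<le>N - j. ?a (k + j))"
    unfolding sum.shift_bounds_cl_nat_ivl by (simp add: atMost_atLeast0)
  also have "\<dots> = (\<Sum>k\<le>N - j. x ^ j * Bernstein (N - j) k x)"
    by (intro sum.cong refl shift) simp
  also have "\<dots> = x ^ j"
    by (simp flip: sum_distrib_left)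
  finally show ?thesis by simp
qed

text \<open>The ratio is the product of the factors \<open>(k - l) / (N - l)\<close> for
  \<open>l < j\<close>, each close to \<open>k / N\<close>, and the errors add up. The bound by 1
  serves the later comparison of products over the coordinates.\<close>

lemma binomial_ratio_approx:
  assumes "k \<le> N" "2 * j \<le> N" "0 < N"
  shows "\<bar>real (k choose j) / real (N choose j) - (real k / real N) ^ j\<bar> \<le> 2 * (real j)\<^sup>2 / real N
    \<and> real (k choose j) / real (N choose j) \<le> 1"
  using assms(2)
proof (induction j)
  case 0
  then show ?case by simp
next
  case (Suc j)
  let ?R = "\<lambda>j. real (k choose j) / real (N choose j)"
  have IH: "\<bar>?R j - (real k / real N) ^ j\<bar> \<le> 2 * (real j)\<^sup>2 / real N" "?R j \<le> 1"
    using Suc by auto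
  have "2 * real (Suc j) \<le> real N"
    using Suc.prems by linarith
  then have Nj: "real N - real j > 0" "2 * (real N - real j) \<ge> real N"
    by simp_all
  have R0: "0 \<le> ?R j" by simp
  have kN: "0 \<le> real k / real N" "real k / real N \<le> 1"
    using assms by auto
  \<comment> \<open>The quadratic error bound grows fast enough to absorb the linear error of one
    more factor.\<close>
  have bound: "2 * (real j)\<^sup>2 / real N + 2 * real j / real N \<le> 2 * (real (Suc j))\<^sup>2 / real N"
    using assms(3) by (simp add: power2_eq_square field_simps)
  show ?case
  proof (cases "j \<le> k")
    case True
    \<comment> \<open>Applied to numerator and denominator, this yields the new factor
      \<open>(k - j) / (N - j)\<close> of the ratio.\<close>
    have step: "real (Suc j) * real (n choose Suc j) = (real n - real j) * real (n choose j)"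
      if "j \<le> n" for n
    proof -
      have "Suc j * (n choose Suc j) = (n - j) * (n choose j)"
        by (metis binomial_absorption binomial_absorb_comp)
      then show ?thesis using that by (metis of_nat_diff of_nat_mult)
    qed
    have "?R (Suc j) = (real (Suc j) * real (k choose Suc j)) / (real (Suc j) * real (N choose Suc j))"
      by (rule mult_divide_mult_cancel_left[symmetric]) simp
    also have "\<dots> = ?R j * ((real k - real j) / (real N - real j))"
      using True Suc.prems by (subst (1 2) step) (auto simp: mult.commute)
    finally have R: "?R (Suc j) = ?R j * ((real k - real j) / (real N - real j))" .
    let ?b = "(real k - real j) / (real N - real j)"
    have b: "0 \<le> ?b" "?b \<le> 1"
      using True Nj assms(1) by auto
    \<comment> \<open>Since \<open>2 * j \<le> N\<close> gives \<open>N \<le> 2 * (N - j)\<close>,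
      the exact difference is at most \<open>2 * j / N\<close>.\<close>
    have "real k / real N - ?b = real j * (real N - real k) / (real N * (real N - real j))"
      using Nj assms(3) by (simp add: field_simps)
    also have "\<dots> = real j / (real N - real j) * ((real N - real k) / real N)"
      by simp
    also have "\<dots> \<le> real j / (real N - real j) * 1"
      using Nj assms by (intro mult_left_mono) auto
    also have "\<dots> \<le> 2 * real j / real N"
      using mult_left_mono[OF Nj(2), of "real j"] Nj(1) assms(3) by (simp add: field_simps)
    finally have "real k / real N - ?b \<le> 2 * real j / real N" .
    moreover have "real k / real N - ?b \<ge> 0"
      using Nj assms by (simp add: \<open>real k / real N - ?b = _\<close>)
    ultimately have d: "\<bar>?b - real k / real N\<bar> \<le> 2 * real j / real N" by linarith
    have "\<bar>?R j * ?b - (real k / real N) ^ j * (real k / real N)\<bar> =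
        \<bar>(?R j - (real k / real N) ^ j) * ?b + (real k / real N) ^ j * (?b - real k / real N)\<bar>"
      by (simp add: algebra_simps)
    also have "\<dots> \<le> \<bar>?R j - (real k / real N) ^ j\<bar> * \<bar>?b\<bar> +
        \<bar>(real k / real N) ^ j\<bar> * \<bar>?b - real k / real N\<bar>"
      unfolding abs_mult[symmetric] by (rule abs_triangle_ineq)
    also have "\<dots> \<le> \<bar>?R j - (real k / real N) ^ j\<bar> * 1 + 1 * \<bar>?b - real k / real N\<bar>"
      using b kN by (intro add_mono mult_left_mono mult_right_mono abs_ge_zero)
        (simp_all only: abs_of_nonneg zero_le_power power_le_one)
    also have "\<dots> \<le> 2 * (real (Suc j))\<^sup>2 / real N"
      using order_trans[OF add_mono[OF IH(1) d] bound] unfolding mult_1 mult_1_right .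
    finally show ?thesis
      using R mult_mono[OF IH(2) b(2)] b by (simp add: mult.commute)
  next
    \<comment> \<open>Beyond \<open>k\<close> the ratio is zero, so the induction hypothesis bounds
      \<open>(k / N) ^ j\<close> itself, and the next power is no larger.\<close>
    case False
    then have R: "?R j = 0" "?R (Suc j) = 0" by (simp_all add: binomial_eq_0)
    have "(real k / real N) ^ j \<le> 2 * (real j)\<^sup>2 / real N"
      using IH(1) unfolding R(1) by simp
    also have "\<dots> \<le> 2 * (real j)\<^sup>2 / real N + 2 * real j / real N"
      by simp
    finally have "(real k / real N) ^ j \<le> 2 * (real (Suc j))\<^sup>2 / real N"
      using bound by (rule order_trans)
    moreover have "(real k / real N) ^ Suc j \<le> (real k / real N) ^ j"
      using kN by (intro power_decreasing) simp_all
    ultimately have "(real k / real N) ^ Suc j \<le> 2 * (real (Suc j))\<^sup>2 / real N"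
      by (rule order_trans[rotated])
    moreover have "0 \<le> (real k / real N) ^ Suc j"
      using kN by (intro zero_le_power)
    ultimately show ?thesis
      unfolding R(2) by (simp only: diff_0 abs_minus_cancel abs_of_nonneg zero_le_one)
  qed
qed

lemma continuous_on_real_polynomial_function:
  "real_polynomial_function p \<Longrightarrow> continuous_on S p"
  by (rule continuous_on_polymonial_function) (simp add: real_polynomial_function_eq)

lemma continuous_pos_lower_bound:
  fixes f :: "'a::topological_space \<Rightarrow> real"
  assumes "compact S" "continuous_on S f" "\<And>x. x \<in> S \<Longrightarrow> 0 < f x"
  obtains e where "0 < e" "\<And>x. x \<in> S \<Longrightarrow> e \<le> f x"
proof (cases "S = {}")
  case False
  then obtain z where "z \<in> S" "\<And>x. x \<in> S \<Longrightarrow> f z \<le> f x"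
    using continuous_attains_inf[OF assms(1) _ assms(2)] by blast
  then show thesis using assms(3) that by blast
qed (use that[of 1] in auto)

text \<open>Bernstein's theorem in several variables: the polynomial has a positive minimum
  \<open>e\<close> on the cube, and for large \<open>N\<close> its coefficients differ from its
  values at grid points by at most \<open>e\<close>.\<close>

lemma pos_on_unit_cube_Bernstein:
  fixes q :: "real ^ 'n::finite \<Rightarrow> real"
  assumes "real_polynomial_function q" and pos: "\<And>y. \<forall>i. 0 \<le> y $ i \<and> y $ i \<le> 1 \<Longrightarrow> 0 < q y"
  obtains N c where "\<And>k. k \<in> (UNIV :: 'n set) \<rightarrow>\<^sub>E {..N} \<Longrightarrow> 0 \<le> c k"
    and "\<And>y. q y = (\<Sum>k\<in>UNIV \<rightarrow>\<^sub>E {..N}. c k * (\<Prod>i\<in>UNIV. Bernstein N (k i) (y $ i)))"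
proof -
  obtain D a where q: "q = (\<lambda>y. \<Sum>\<alpha>\<in>multi_indices D. a \<alpha> * monomial_fun \<alpha> y)"
    using assms(1) unfolding real_polynomial_function_iff_poly_upto poly_upto_def by blast
  have deg: "\<alpha> i \<le> D" if "\<alpha> \<in> multi_indices D" for \<alpha> and i :: 'n
    using member_le_sum[of i UNIV \<alpha>] that by (simp add: multi_indices_def)
  let ?C = "cbox (\<chi> i. 0) (\<chi> i. 1) :: (real ^ 'n) set"
  have "0 < q y" if "y \<in> ?C" for y
    using that by (intro pos) (simp add: mem_box_cart)
  then obtain e where e: "0 < e" "\<And>y. y \<in> ?C \<Longrightarrow> e \<le> q y"
    by (rule continuous_pos_lower_bound[OF compact_cbox continuous_on_real_polynomial_function[OF assms(1)]])
      (assumption, rule that)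
  define A where "A = (\<Sum>\<alpha>\<in>multi_indices D. \<bar>a \<alpha>\<bar>)"
  let ?n = "real CARD('n)"
  obtain N0 :: nat where N0: "A * ?n * (2 * (real D)\<^sup>2) / e < real N0"
    using reals_Archimedean2 by blast
  \<comment> \<open>\<open>N0\<close> pushes the total coefficient error below \<open>e\<close>,
    \<open>2 * D\<close> admits every exponent in the ratio estimate, and the final 1 makes
    \<open>N\<close> positive.\<close>
  define N where "N = N0 + 2 * D + 1"
  have N: "2 * D \<le> N" "0 < N" "N0 \<le> N" by (auto simp: N_def)
  have small: "A * (?n * (2 * (real D)\<^sup>2 / real N)) \<le> e"
  proof -
    have "A * ?n * (2 * (real D)\<^sup>2) / e < real N" using N0 N(3) by linarith
    then show ?thesis using e(1) N(2) by (simp add: field_simps)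
  qed
  \<comment> \<open>Expanding the monomials of \<open>q\<close> in the Bernstein basis, the coefficient at \<open>k\<close> tends to \<open>q (k / N)\<close>
    uniformly in \<open>k\<close>.\<close>
  let ?R = "\<lambda>j k. real (k choose j) / real (N choose j)"
  define c where "c = (\<lambda>k. \<Sum>\<alpha>\<in>multi_indices D. a \<alpha> * (\<Prod>i\<in>UNIV. ?R (\<alpha> i) (k i)))"
  show thesis
  proof (rule that)
    fix k :: "'n \<Rightarrow> nat" assume k: "k \<in> UNIV \<rightarrow>\<^sub>E {..N}"
    then have kN: "k i \<le> N" for i by (auto simp: PiE_iff)
    let ?y = "\<chi> i. real (k i) / real N"
    have close: "\<bar>(\<Prod>i\<in>UNIV. ?R (\<alpha> i) (k i)) - monomial_fun \<alpha> ?y\<bar> \<le> ?n * (2 * (real D)\<^sup>2 / real N)"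
      if \<alpha>: "\<alpha> \<in> multi_indices D" for \<alpha>
    proof -
      have approx: "\<bar>?R (\<alpha> i) (k i) - (real (k i) / real N) ^ \<alpha> i\<bar> \<le> 2 * (real (\<alpha> i))\<^sup>2 / real N
          \<and> ?R (\<alpha> i) (k i) \<le> 1" for i
        using deg[OF \<alpha>, of i] N kN by (intro binomial_ratio_approx) auto
      have "(real (\<alpha> i))\<^sup>2 \<le> (real D)\<^sup>2" for i
        using deg[OF \<alpha>, of i] by (intro power_mono) auto
      then have "2 * (real (\<alpha> i))\<^sup>2 / real N \<le> 2 * (real D)\<^sup>2 / real N" for i
        by (intro divide_right_mono) auto
      then have "\<bar>?R (\<alpha> i) (k i) - (real (k i) / real N) ^ \<alpha> i\<bar> \<le> 2 * (real D)\<^sup>2 / real N" for i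
        using approx[of i] by (meson order_trans)
      then have "(\<Sum>i\<in>UNIV. norm (?R (\<alpha> i) (k i) - (real (k i) / real N) ^ \<alpha> i)) \<le>
          ?n * (2 * (real D)\<^sup>2 / real N)"
        using sum_bounded_above[of UNIV "\<lambda>i. norm (?R (\<alpha> i) (k i) - (real (k i) / real N) ^ \<alpha> i)"
            "2 * (real D)\<^sup>2 / real N"]
        by simp
      \<comment> \<open>Factors of absolute value at most 1 can be exchanged one at a time, so the
        errors only add.\<close>
      moreover have "norm ((\<Prod>i\<in>UNIV. ?R (\<alpha> i) (k i)) - (\<Prod>i\<in>UNIV. (real (k i) / real N) ^ \<alpha> i)) \<le>
          (\<Sum>i\<in>UNIV. norm (?R (\<alpha> i) (k i) - (real (k i) / real N) ^ \<alpha> i))"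
        using approx kN N(2) by (intro norm_prod_diff) (auto intro!: power_le_one)
      ultimately show ?thesis
        by (simp add: monomial_fun_def)
    qed
    have "\<bar>c k - q ?y\<bar> = \<bar>\<Sum>\<alpha>\<in>multi_indices D. a \<alpha> * ((\<Prod>i\<in>UNIV. ?R (\<alpha> i) (k i)) - monomial_fun \<alpha> ?y)\<bar>"
      by (simp add: c_def q sum_subtractf right_diff_distrib)
    also have "\<dots> \<le> (\<Sum>\<alpha>\<in>multi_indices D. \<bar>a \<alpha>\<bar> * (?n * (2 * (real D)\<^sup>2 / real N)))"
      by (rule order_trans[OF sum_abs sum_mono])
        (unfold abs_mult, intro mult_left_mono close, auto)
    also have "\<dots> \<le> e"
      using small unfolding A_def sum_distrib_right .
    finally have "\<bar>c k - q ?y\<bar> \<le> e" .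
    moreover have "e \<le> q ?y"
      using kN N(2) by (intro e(2)) (auto simp: mem_box_cart)
    ultimately show "0 \<le> c k" by linarith
  next
    fix y :: "real ^ 'n"
    have "q y = (\<Sum>\<alpha>\<in>multi_indices D. a \<alpha> *
        (\<Prod>i\<in>UNIV. \<Sum>k\<le>N. ?R (\<alpha> i) k * Bernstein N k (y $ i)))"
      unfolding q monomial_fun_def
    proof (intro sum.cong refl arg_cong2[where f = "(*)"] prod.cong)
      fix \<alpha> :: "'n \<Rightarrow> nat" and i assume "\<alpha> \<in> multi_indices D"
      then show "(y $ i) ^ \<alpha> i = (\<Sum>k\<le>N. ?R (\<alpha> i) k * Bernstein N k (y $ i))"
        using deg[of \<alpha> i] N by (intro power_eq_sum_Bernstein) auto
    qed
    also have "\<dots> = (\<Sum>\<alpha>\<in>multi_indices D. \<Sum>k\<in>UNIV \<rightarrow>\<^sub>E {..N}.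
        a \<alpha> * (\<Prod>i\<in>UNIV. ?R (\<alpha> i) (k i)) * (\<Prod>i\<in>UNIV. Bernstein N (k i) (y $ i)))"
      by (subst prod_sum_PiE) (auto simp: prod.distrib sum_distrib_left mult.assoc simp del: times_divide_eq_left)
    also have "\<dots> = (\<Sum>k\<in>UNIV \<rightarrow>\<^sub>E {..N}. c k * (\<Prod>i\<in>UNIV. Bernstein N (k i) (y $ i)))"
      unfolding c_def sum_distrib_right by (rule sum.swap)
    finally show "q y = (\<Sum>k\<in>UNIV \<rightarrow>\<^sub>E {..N}. c k * (\<Prod>i\<in>UNIV. Bernstein N (k i) (y $ i)))" .
  qed
qed

text \<open>Under the substitution from the unit interval, \<open>y\<close> and \<open>1 - y\<close>
  become \<open>(r + x $ i) / (2 * r)\<close> and \<open>(r - x $ i) / (2 * r)\<close>, both in the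
  preorder.\<close>

lemma ball_preorder_Bernstein:
  fixes i :: "'n::finite"
  assumes "r > 0"
  shows "(\<lambda>x. Bernstein N k ((r + x $ i) / (2 * r))) \<in> ball_preorder r"
proof -
  have u: "(\<lambda>x. 1 / (2 * r) * (r + x $ i)) \<in> ball_preorder r"
    using assms ball_preorder_component[of r 1 i]
    by (intro ball_preorder_mult ball_preorder_const) auto
  have v: "(\<lambda>x. 1 / (2 * r) * (r + - 1 * x $ i)) \<in> ball_preorder r"
    using assms by (intro ball_preorder_mult ball_preorder_const ball_preorder_component) auto
  have "(\<lambda>x. real (N choose k) * (1 / (2 * r) * (r + x $ i)) ^ k *
      (1 / (2 * r) * (r + - 1 * x $ i)) ^ (N - k)) \<in> ball_preorder r"
    by (rule ball_preorder_mult[OF ball_preorder_mult[OF ball_preorder_const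
            ball_preorder_power[OF u]] ball_preorder_power[OF v]]) simp
  moreover have "1 - (r + x) / (2 * r) = 1 / (2 * r) * (r + - 1 * x)" for x
    using assms by (simp add: field_simps)
  ultimately show ?thesis
    by (simp add: Bernstein_def)
qed

text \<open>The affine map \<open>?s\<close> carries the unit cube to the cube of half-width
  \<open>r\<close>. Nonnegative Bernstein coefficients then express \<open>p\<close> through
  products of elements of the preorder.\<close>

lemma pos_on_cube_ball_preorder:
  fixes p :: "real ^ 'n::finite \<Rightarrow> real"
  assumes "r > 0" "real_polynomial_function p" and pos: "\<And>x. (\<And>i. \<bar>x $ i\<bar> \<le> r) \<Longrightarrow> 0 < p x"
  shows "p \<in> ball_preorder r"
proof -
  let ?s = "\<lambda>y :: real ^ 'n. \<chi> i. r * (2 * y $ i - 1)"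
  have "polynomial_function ?s"
  proof -
    have "real_polynomial_function (\<lambda>y :: real ^ 'n. r * (2 * y $ i - 1))" for i
      by (intro real_polynomial_function.intros(2,4) real_polynomial_function_diff
          real_polynomial_function_component)
    then show ?thesis
      by (simp add: polynomial_function_iff_Basis_inner Basis_vec_def inner_axis)
  qed
  then have "real_polynomial_function (p \<circ> ?s)"
    using assms(2) by (rule real_polynomial_function_compose)
  moreover have "0 < (p \<circ> ?s) y" if "\<forall>i. 0 \<le> y $ i \<and> y $ i \<le> 1" for y
  proof -
    have "\<bar>?s y $ i\<bar> \<le> r" for i
    proof -
      have "\<bar>2 * y $ i - 1\<bar> \<le> 1"
        using spec[OF that, of i] by (simp only: abs_le_iff) linarith
      from mult_left_mono[OF this, of r] show ?thesis
        using assms(1) by (simp add: abs_mult)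
    qed
    then show ?thesis unfolding o_apply by (rule pos)
  qed
  ultimately obtain N c where c: "\<And>k. k \<in> (UNIV :: 'n set) \<rightarrow>\<^sub>E {..N} \<Longrightarrow> 0 \<le> c k"
    "\<And>y. (p \<circ> ?s) y = (\<Sum>k\<in>UNIV \<rightarrow>\<^sub>E {..N}. c k * (\<Prod>i\<in>UNIV. Bernstein N (k i) (y $ i)))"
    by (rule pos_on_unit_cube_Bernstein) (assumption, rule that)
  have "p x = (\<Sum>k\<in>UNIV \<rightarrow>\<^sub>E {..N}. c k * (\<Prod>i\<in>UNIV. Bernstein N (k i) ((r + x $ i) / (2 * r))))" for x
  proof -
    have "?s (\<chi> i. (r + x $ i) / (2 * r)) = x"
      using assms(1) by (simp add: vec_eq_iff field_simps)
    then show ?thesis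
      using c(2)[of "\<chi> i. (r + x $ i) / (2 * r)"] by simp
  qed
  then have "p = (\<lambda>x. \<Sum>k\<in>UNIV \<rightarrow>\<^sub>E {..N}. c k *
      (\<Prod>i\<in>UNIV. Bernstein N (k i) ((r + x $ i) / (2 * r))))"
    by (rule ext)
  moreover have "\<dots> \<in> ball_preorder r"
    by (rule ball_preorder_sum, rule ball_preorder_mult[OF ball_preorder_const ball_preorder_prod])
      (simp_all only: c(1) ball_preorder_Bernstein[OF assms(1)])
  ultimately show ?thesis by (rule ssubst[where P = "\<lambda>q. q \<in> ball_preorder r"])
qed

section \<open>From the cube to the ball: a Positivstellensatz\<close>

lemma compact_continuous_abs_bound:
  fixes f :: "'a::topological_space \<Rightarrow> real"
  assumes "compact S" "continuous_on S f"
  obtains M where "0 < M" "\<And>x. x \<in> S \<Longrightarrow> \<bar>f x\<bar> \<le> M"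
  using compact_imp_bounded[OF compact_continuous_image[OF assms(2,1)]]
  unfolding bounded_pos by auto

text \<open>Approximate \<open>sqrt (f x)\<close> by a polynomial and square it.\<close>

lemma approx_by_square:
  fixes f :: "'a::euclidean_space \<Rightarrow> real"
  assumes "compact S" "continuous_on S f" "\<And>x. x \<in> S \<Longrightarrow> 0 \<le> f x" "0 < e"
  obtains q where "real_polynomial_function q" "\<And>x. x \<in> S \<Longrightarrow> \<bar>f x - (q x)\<^sup>2\<bar> < e"
proof -
  have cont: "continuous_on S (\<lambda>x. sqrt (f x))"
    using assms(2) by (rule continuous_on_real_sqrt)
  obtain M where M: "0 < M" "\<And>x. x \<in> S \<Longrightarrow> \<bar>sqrt (f x)\<bar> \<le> M"
    by (rule compact_continuous_abs_bound[OF assms(1) cont]) (rule that)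
  \<comment> \<open>The error factors as \<open>(sqrt (f x) - q x) * (sqrt (f x) + q x)\<close>.
    With \<open>\<delta> \<le> 1\<close> the second factor is at most
    \<open>2 * M + 1\<close>.\<close>
  define \<delta> where "\<delta> = min 1 (e / (2 * M + 1))"
  have "\<delta> \<le> e / (2 * M + 1)"
    by (simp add: \<delta>_def)
  then have \<delta>3: "\<delta> * (2 * M + 1) \<le> e"
    using M(1) by (simp add: pos_le_divide_eq)
  have \<delta>: "0 < \<delta>" "\<delta> \<le> 1"
    using assms(4) M(1) by (simp_all add: \<delta>_def)
  obtain q where q: "real_polynomial_function q" "\<And>x. x \<in> S \<Longrightarrow> \<bar>sqrt (f x) - q x\<bar> < \<delta>"
    by (rule Stone_Weierstrass_real_polynomial_function[OF assms(1) cont \<delta>(1)]) (rule that)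
  show thesis
  proof (rule that[OF q(1)])
    fix x assume x: "x \<in> S"
    let ?s = "sqrt (f x)"
    have "f x - (q x)\<^sup>2 = (?s - q x) * (?s + q x)"
      using assms(3)[OF x] by (simp add: algebra_simps power2_eq_square)
    then have "\<bar>f x - (q x)\<^sup>2\<bar> = \<bar>?s - q x\<bar> * \<bar>?s + q x\<bar>"
      by (simp add: abs_mult)
    also have "\<dots> \<le> \<bar>?s - q x\<bar> * (2 * M + 1)"
      using q(2)[OF x] M(2)[OF x] \<delta>(2) by (intro mult_left_mono) linarith+
    also have "\<dots> < \<delta> * (2 * M + 1)"
      using q(2)[OF x] M(1) by (intro mult_strict_right_mono) auto
    finally show "\<bar>f x - (q x)\<^sup>2\<bar> < e" using \<delta>3 by linarith
  qed
qed

text \<open>Puts membership in the shape of the constraints: a multiplier whose subtraction leaves a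
  sum of squares.\<close>

lemma ball_preorder_multiplier:
  assumes "p \<in> ball_preorder r"
  shows "\<exists>t. is_sos t \<and> is_sos (\<lambda>x. p x - t x * (r\<^sup>2 - (norm x)\<^sup>2))"
proof -
  obtain s t where st: "is_sos s" "is_sos t" "\<And>x. p x = s x + t x * (r\<^sup>2 - (norm x)\<^sup>2)"
    using assms by (rule ball_preorderE) (rule that)
  have "(\<lambda>x. p x - t x * (r\<^sup>2 - (norm x)\<^sup>2)) = s"
    using st(3) by (intro ext) simp
  then show ?thesis using st(1,2) by (intro exI[of _ t]) simp
qed

text \<open>Outside the ball \<open>?h\<close> is negative, so subtracting \<open>q^2 * ?h\<close>
  lifts \<open>p\<close> there; if \<open>q\<close> is nearly zero on the ball, positivity survives
  inside.\<close>

lemma pos_on_ball_ball_preorder: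
  fixes p :: "real ^ 'n::finite \<Rightarrow> real"
  assumes "r > 0" "real_polynomial_function p" and pos: "\<And>x. norm x \<le> r \<Longrightarrow> 0 < p x"
  shows "p \<in> ball_preorder r"
proof -
  let ?h = "\<lambda>x :: real ^ 'n. r\<^sup>2 - (norm x)\<^sup>2"
  let ?B = "cbox (\<chi> i. - r) (\<chi> i. r) :: (real ^ 'n) set"
  have contp: "continuous_on S p" for S
    using assms(2) by (rule continuous_on_real_polynomial_function)
  have conth: "continuous_on S ?h" for S
    by (intro continuous_intros)
  have "0 < p x" if "x \<in> cball 0 r" for x
    using that pos by simp
  then obtain e where e: "0 < e" "\<And>x. x \<in> cball 0 r \<Longrightarrow> e \<le> p x"
    by (rule continuous_pos_lower_bound[OF compact_cball contp]) (assumption, rule that)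
  \<comment> \<open>The part of the cube that needs lifting. It misses the ball, where
    \<open>p\<close> is at least \<open>e\<close>, so \<open>- ?h\<close> has a positive lower bound
    on it.\<close>
  let ?K = "?B \<inter> {x. p x \<le> e / 2}"
  have "compact ?K"
    by (intro compact_Int_closed compact_cbox closed_Collect_le contp continuous_on_const)
  moreover have "continuous_on ?K (\<lambda>x. - ?h x)"
    by (intro continuous_on_minus conth)
  moreover have "0 < - ?h x" if "x \<in> ?K" for x
  proof -
    have "\<not> norm x \<le> r" using that e by force
    then show ?thesis using assms(1) by (simp add: power_strict_mono)
  qed
  ultimately obtain \<eta> where \<eta>: "0 < \<eta>" "\<And>x. x \<in> ?K \<Longrightarrow> \<eta> \<le> - ?h x"
    by (rule continuous_pos_lower_bound) (assumption, rule that)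
  \<comment> \<open>\<open>\<sigma>\<close> vanishes where \<open>p\<close> is large, in particular on the ball, and lifts \<open>p\<close> to \<open>e / 2\<close> elsewhere.\<close>
  define \<sigma> where "\<sigma> = (\<lambda>x. max 0 (e / 2 - p x) / \<eta>)"
  have \<sigma>0: "0 \<le> \<sigma> x" for x using \<eta>(1) by (simp add: \<sigma>_def)
  have \<sigma>: "e / 2 \<le> p x - \<sigma> x * ?h x" if "x \<in> ?B" for x
  proof (cases "p x \<le> e / 2")
    case True
    then have "\<sigma> x * \<eta> \<le> \<sigma> x * - ?h x"
      using that \<sigma>0 \<eta>(2) by (intro mult_left_mono) auto
    moreover have "\<sigma> x * \<eta> = e / 2 - p x"
      using True \<eta>(1) by (simp add: \<sigma>_def)
    ultimately show ?thesis by (simp add: algebra_simps)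
  next
    case False
    then show ?thesis by (simp add: \<sigma>_def)
  qed
  obtain M where M: "0 < M" "\<And>x. x \<in> ?B \<Longrightarrow> \<bar>?h x\<bar> \<le> M"
    by (rule compact_continuous_abs_bound[OF compact_cbox conth]) (rule that)
  have cont\<sigma>: "continuous_on ?B \<sigma>"
    unfolding \<sigma>_def using \<eta>(1) by (intro continuous_intros contp) auto
  \<comment> \<open>With this accuracy, replacing \<open>\<sigma>\<close> by a square costs less
    than the margin \<open>e / 2\<close>.\<close>
  have "0 < e / 2 / M" using e(1) M(1) by simp
  then obtain q where q: "real_polynomial_function q"
    "\<And>x. x \<in> ?B \<Longrightarrow> \<bar>\<sigma> x - (q x)\<^sup>2\<bar> < e / 2 / M"
    using approx_by_square[OF compact_cbox cont\<sigma> \<sigma>0] by blast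
  have poly: "real_polynomial_function (\<lambda>x. p x - (q x)\<^sup>2 * ?h x)"
    by (intro real_polynomial_function_diff real_polynomial_function.intros(4)
        real_polynomial_function_power real_polynomial_function_ball assms(2) q(1))
  have "(\<lambda>x. p x - (q x)\<^sup>2 * ?h x) \<in> ball_preorder r"
  proof (rule pos_on_cube_ball_preorder[OF assms(1) poly])
    fix x :: "real ^ 'n" assume "\<And>i. \<bar>x $ i\<bar> \<le> r"
    then have x: "x \<in> ?B" by (auto simp: mem_box_cart abs_le_iff minus_le_iff)
    have "\<bar>(\<sigma> x - (q x)\<^sup>2) * ?h x\<bar> \<le> \<bar>\<sigma> x - (q x)\<^sup>2\<bar> * M"
      unfolding abs_mult using M(2)[OF x] by (intro mult_left_mono) auto
    also have "\<dots> < e / 2 / M * M"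
      using q(2)[OF x] M(1) by (intro mult_strict_right_mono)
    also have "\<dots> = e / 2" using M(1) by simp
    finally have "\<bar>(\<sigma> x - (q x)\<^sup>2) * ?h x\<bar> < e / 2" .
    moreover have "p x - (q x)\<^sup>2 * ?h x = (p x - \<sigma> x * ?h x) + (\<sigma> x - (q x)\<^sup>2) * ?h x"
      by (simp add: algebra_simps)
    ultimately show "0 < p x - (q x)\<^sup>2 * ?h x"
      using \<sigma>[OF x] by linarith
  qed
  moreover have "(\<lambda>x. (q x)\<^sup>2 * ?h x) \<in> ball_preorder r"
    by (rule ball_preorderI[OF is_sos_zero is_sos_square[OF q(1)]]) simp
  ultimately show ?thesis
    using ball_preorder_add by force
qed

subsection \<open>Feasibility with small gap\<close>

lemma continuous_on_Max_image:
  fixes f :: "'i \<Rightarrow> 'a::topological_space \<Rightarrow> 'b::linorder_topology"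
  assumes "finite I" "I \<noteq> {}" "\<And>i. i \<in> I \<Longrightarrow> continuous_on S (f i)"
  shows "continuous_on S (\<lambda>x. Max ((\<lambda>i. f i x) ` I))"
  using assms by (induction I rule: finite_ne_induct) (auto intro!: continuous_on_max)

text \<open>One fixed pair \<open>J\<close>, \<open>P\<close> with fixed certificates serves every
  large degree, which is what comparison with the optimal values requires.\<close>

lemma ex_feasible_I:
  fixes g :: "nat \<Rightarrow> real ^ 'n::finite \<Rightarrow> real"
  assumes r: "r > 0" and m: "0 < m" and g: "\<And>i. i \<in> {1..m} \<Longrightarrow> real_polynomial_function (g i)"
    and \<epsilon>: "0 < \<epsilon>"
  shows "\<exists>J P. \<forall>\<^sub>F d in sequentially. feasible_I d r m g J P \<epsilon>"
proof -
  let ?I = "{1..m}"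
  let ?L = "cball 0 r :: (real ^ 'n) set"
  let ?h = "\<lambda>x :: real ^ 'n. r\<^sup>2 - (norm x)\<^sup>2"
  define V where "V = (\<lambda>x. Max ((\<lambda>i. g i x) ` ?I))"
  have contg: "continuous_on ?L (g i)" if "i \<in> ?I" for i
    using g[OF that] by (rule continuous_on_real_polynomial_function)
  have contV: "continuous_on ?L V"
    unfolding V_def using m contg by (intro continuous_on_Max_image) auto
  have gV: "g i x \<le> V x" if "i \<in> ?I" for i x
    unfolding V_def using that by (intro Max_ge) auto
  have V_attained: "\<exists>i\<in>?I. V x = g i x" for x
  proof -
    have "V x \<in> (\<lambda>i. g i x) ` ?I"
      unfolding V_def using m by (intro Max_in) auto
    then show ?thesis by (simp only: image_iff)
  qed
  \<comment> \<open>\<open>J\<close> will lie between \<open>V + \<eta>\<close> and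
    \<open>V + 3 * \<eta>\<close>, and \<open>P\<close> between \<open>V - 3 * \<eta>\<close> and
    \<open>V - \<eta>\<close>, so the gap is below \<open>6 * \<eta> < \<epsilon>\<close>.\<close>
  define \<eta> where "\<eta> = \<epsilon> / 7"
  have \<eta>: "0 < \<eta>" using \<epsilon> by (simp add: \<eta>_def)
  have "continuous_on ?L (\<lambda>x. V x + 2 * \<eta>)" "continuous_on ?L (\<lambda>x. V x - 2 * \<eta>)"
    by (intro continuous_intros contV)+
  from this[THEN Stone_Weierstrass_real_polynomial_function[OF compact_cball _ \<eta>]]
  obtain J P where
    J: "real_polynomial_function J" "\<And>x. x \<in> ?L \<Longrightarrow> \<bar>(V x + 2 * \<eta>) - J x\<bar> < \<eta>" and
    P: "real_polynomial_function P" "\<And>x. x \<in> ?L \<Longrightarrow> \<bar>(V x - 2 * \<eta>) - P x\<bar> < \<eta>"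
    by metis
  \<comment> \<open>The normalised weights \<open>u j / U\<close> live on the indices with \<open>g j\<close> close to \<open>V\<close>, so the weighted mean
    of the \<open>g j\<close> is close to \<open>V\<close>; their approximate square roots \<open>q j\<close> give the multipliers \<open>s2 i j\<close>,
    which do not depend on \<open>i\<close>.\<close>
  define u where "u = (\<lambda>j x. max 0 (g j x - V x + \<eta> / 2))"
  define U where "U = (\<lambda>x. \<Sum>j\<in>?I. u j x)"
  have u0: "0 \<le> u j x" for j x by (simp add: u_def)
  have U: "0 < U x" for x
  proof -
    obtain i where "i \<in> ?I" "V x = g i x" using V_attained by blast
    then show ?thesis unfolding U_def
      using \<eta> by (intro sum_pos2[of _ i]) (auto simp: u_def)
  qed
  have contU: "continuous_on ?L U"
    unfolding U_def u_def by (intro continuous_intros contV contg)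
  have contw: "continuous_on ?L (\<lambda>x. u j x / U x)" if "j \<in> ?I" for j
    using that U unfolding u_def
    by (intro continuous_on_divide continuous_intros contU contV contg) (auto simp: less_le)
  have w_mean: "V x - \<eta> / 2 \<le> (\<Sum>j\<in>?I. u j x / U x * g j x)" for x
  proof -
    have "(\<Sum>j\<in>?I. u j x * (V x - \<eta> / 2)) \<le> (\<Sum>j\<in>?I. u j x * g j x)"
    proof (rule sum_mono)
      fix j
      show "u j x * (V x - \<eta> / 2) \<le> u j x * g j x"
        by (cases "V x - \<eta> / 2 \<le> g j x") (auto simp: u_def intro: mult_left_mono)
    qed
    then have "U x * (V x - \<eta> / 2) \<le> (\<Sum>j\<in>?I. u j x * g j x)"
      by (simp add: U_def sum_distrib_right)
    then have "V x - \<eta> / 2 \<le> (\<Sum>j\<in>?I. u j x * g j x) / U x"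
      using U[of x] by (simp add: pos_le_divide_eq mult.commute)
    then show ?thesis by (simp add: sum_divide_distrib)
  qed
  have w_sum: "(\<Sum>j\<in>?I. u j x / U x) = 1" for x
    using U[of x] by (simp add: U_def flip: sum_divide_distrib)
  have "\<exists>G>0. \<forall>x\<in>?L. \<bar>g i x - g j x\<bar> \<le> G" if "i \<in> ?I" "j \<in> ?I" for i j
    using compact_continuous_abs_bound[OF compact_cball continuous_on_diff[OF contg contg]] that
    by metis
  then obtain G' where G': "\<And>i j. i \<in> ?I \<Longrightarrow> j \<in> ?I \<Longrightarrow> 0 < G' i j"
    "\<And>i j x. i \<in> ?I \<Longrightarrow> j \<in> ?I \<Longrightarrow> x \<in> ?L \<Longrightarrow> \<bar>g i x - g j x\<bar> \<le> G' i j"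
    by metis
  define G where "G = (\<Sum>i\<in>?I. \<Sum>j\<in>?I. G' i j)"
  have G: "\<bar>g i x - g j x\<bar> \<le> G" if "i \<in> ?I" "j \<in> ?I" "x \<in> ?L" for i j x
  proof -
    have "G' i j \<le> (\<Sum>j\<in>?I. G' i j)"
      using G'(1) that by (intro member_le_sum) (auto simp: less_imp_le)
    also have "\<dots> \<le> G"
      unfolding G_def using G'(1) that
      by (intro member_le_sum[of i ?I "\<lambda>i. \<Sum>j\<in>?I. G' i j"] sum_nonneg) (auto simp: less_imp_le)
    finally show ?thesis using G'(2)[OF that] by linarith
  qed
  have G0: "0 \<le> G" unfolding G_def using G'(1) by (intro sum_nonneg) (auto simp: less_imp_le)
  \<comment> \<open>Each of the \<open>m\<close> approximate weights contributes an error of at most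
    \<open>\<delta> * G\<close>, in total at most \<open>\<eta> / 2\<close>. Using
    \<open>G + 1\<close> keeps the denominator positive.\<close>
  define \<delta> where "\<delta> = \<eta> / (2 * real m * (G + 1))"
  have \<delta>0: "0 < \<delta>"
    unfolding \<delta>_def using \<eta> m G0 by (intro divide_pos_pos mult_pos_pos) auto
  have \<delta>: "real m * (\<delta> * G) \<le> \<eta> / 2"
  proof -
    have "real m * (\<delta> * G) = \<eta> / 2 * (G / (G + 1))"
      using m by (simp add: \<delta>_def)
    also have "\<dots> \<le> \<eta> / 2 * 1"
      using \<eta> G0 by (intro mult_left_mono) auto
    finally show ?thesis by simp
  qed
  have "\<exists>q. real_polynomial_function q \<and> (\<forall>x\<in>?L. \<bar>u j x / U x - (q x)\<^sup>2\<bar> < \<delta>)" if "j \<in> ?I" for j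
    using approx_by_square[OF compact_cball contw[OF that] _ \<delta>0] u0 U
    by (metis divide_nonneg_pos)
  then obtain q where q: "\<And>j. j \<in> ?I \<Longrightarrow> real_polynomial_function (q j)"
    "\<And>j x. j \<in> ?I \<Longrightarrow> x \<in> ?L \<Longrightarrow> \<bar>u j x / U x - (q j x)\<^sup>2\<bar> < \<delta>"
    by metis
  \<comment> \<open>Exact weights would replace \<open>g i\<close> by the weighted mean, which is at
    least \<open>V - \<eta> / 2\<close>. As \<open>P < V - \<eta>\<close>, the remaining
    \<open>\<eta> / 2\<close> absorbs the error of the squares.\<close>
  have "(\<lambda>x. g i x - P x - (\<Sum>j\<in>?I. (q j x)\<^sup>2 * (g i x - g j x))) \<in> ball_preorder r"
    if i: "i \<in> ?I" for i
  proof (rule pos_on_ball_ball_preorder[OF r])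
    show "real_polynomial_function (\<lambda>x. g i x - P x - (\<Sum>j\<in>?I. (q j x)\<^sup>2 * (g i x - g j x)))"
      using q(1) g i P(1)
      by (intro real_polynomial_function_diff real_polynomial_function_sum
          real_polynomial_function.intros(4) real_polynomial_function_power) auto
    fix x :: "real ^ 'n" assume "norm x \<le> r"
    then have x: "x \<in> ?L" by simp
    have "(\<Sum>j\<in>?I. u j x / U x * (g i x - g j x)) =
        g i x * (\<Sum>j\<in>?I. u j x / U x) - (\<Sum>j\<in>?I. u j x / U x * g j x)"
      by (simp add: right_diff_distrib sum_subtractf sum_distrib_left mult.commute)
    then have exact: "(\<Sum>j\<in>?I. u j x / U x * (g i x - g j x)) \<le> g i x - (V x - \<eta> / 2)"
      using w_mean[of x] w_sum[of x] by simp
    have "(\<Sum>j\<in>?I. ((q j x)\<^sup>2 - u j x / U x) * (g i x - g j x)) \<le> (\<Sum>j\<in>?I. \<delta> * G)"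
    proof (rule sum_mono)
      fix j assume j: "j \<in> ?I"
      have "\<bar>((q j x)\<^sup>2 - u j x / U x) * (g i x - g j x)\<bar> \<le> \<delta> * G"
        unfolding abs_mult using q(2)[OF j x] G[OF i j x] \<delta>0
        by (intro mult_mono) linarith+
      then show "((q j x)\<^sup>2 - u j x / U x) * (g i x - g j x) \<le> \<delta> * G" by linarith
    qed
    also have "\<dots> = real m * (\<delta> * G)" by simp
    also have "\<dots> \<le> \<eta> / 2" by (rule \<delta>)
    finally have "(\<Sum>j\<in>?I. ((q j x)\<^sup>2 - u j x / U x) * (g i x - g j x)) \<le> \<eta> / 2" .
    moreover have "(\<Sum>j\<in>?I. (q j x)\<^sup>2 * (g i x - g j x)) =
        (\<Sum>j\<in>?I. u j x / U x * (g i x - g j x)) +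
        (\<Sum>j\<in>?I. ((q j x)\<^sup>2 - u j x / U x) * (g i x - g j x))"
      by (simp only: left_diff_distrib sum_subtractf)
    ultimately have "(\<Sum>j\<in>?I. (q j x)\<^sup>2 * (g i x - g j x)) \<le> g i x - V x + \<eta>"
      using exact by linarith
    moreover have "P x < V x - \<eta>"
      using P(2)[OF x] by linarith
    ultimately show "0 < g i x - P x - (\<Sum>j\<in>?I. (q j x)\<^sup>2 * (g i x - g j x))"
      by linarith
  qed
  then have "\<forall>i\<in>?I. \<exists>t. is_sos t \<and>
      is_sos (\<lambda>x. (g i x - P x - (\<Sum>j\<in>?I. (q j x)\<^sup>2 * (g i x - g j x))) - t x * ?h x)"
    by (intro ballI ball_preorder_multiplier)
  from bchoice[OF this] obtain s1 where s1: "\<forall>i\<in>?I. is_sos (s1 i) \<and>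
      is_sos (\<lambda>x. (g i x - P x - (\<Sum>j\<in>?I. (q j x)\<^sup>2 * (g i x - g j x))) - s1 i x * ?h x)"
    by (rule exE)
  \<comment> \<open>The multiplier of the ball was found last but is subtracted first in
    \<open>feasible_I\<close>.\<close>
  have swap: "(g i x - P x - c) - s1 i x * ?h x = (g i x - P x) - s1 i x * ?h x - c" for i x c
    by simp
  have "(\<lambda>x. J x - g i x) \<in> ball_preorder r" if i: "i \<in> ?I" for i
  proof (rule pos_on_ball_ball_preorder[OF r real_polynomial_function_diff[OF J(1) g[OF i]]])
    fix x :: "real ^ 'n" assume "norm x \<le> r"
    then show "0 < J x - g i x"
      using J(2)[of x] gV[OF i, of x] \<eta> by simp
  qed
  then have "\<forall>i\<in>?I. \<exists>t. is_sos t \<and> is_sos (\<lambda>x. (J x - g i x) - t x * ?h x)"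
    by (intro ballI ball_preorder_multiplier)
  from bchoice[OF this] obtain s3 where s3: "\<forall>i\<in>?I. is_sos (s3 i) \<and>
      is_sos (\<lambda>x. (J x - g i x) - s3 i x * ?h x)"
    by (rule exE)
  have "(\<lambda>x. \<epsilon> - (J x - P x)) \<in> ball_preorder r"
  proof (rule pos_on_ball_ball_preorder[OF r])
    show "real_polynomial_function (\<lambda>x. \<epsilon> - (J x - P x))"
      by (intro real_polynomial_function_diff real_polynomial_function.intros(2) J(1) P(1))
    fix x :: "real ^ 'n" assume "norm x \<le> r"
    then have x: "x \<in> ?L" by simp
    have "\<epsilon> = 7 * \<eta>" by (simp add: \<eta>_def)
    then show "0 < \<epsilon> - (J x - P x)"
      using J(2)[OF x] P(2)[OF x] \<eta> by linarith
  qed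
  from ball_preorder_multiplier[OF this] obtain s4 where s4: "is_sos s4"
    "is_sos (\<lambda>x. \<epsilon> - (J x - P x) - s4 x * ?h x)"
    by (elim exE conjE)
  have "\<forall>\<^sub>F d in sequentially. J \<in> poly_upto d \<and> P \<in> poly_upto d \<and>
      (\<forall>i\<in>?I. s1 i \<in> sos_upto d) \<and> (\<forall>i\<in>?I. \<forall>j\<in>?I. (\<lambda>x. (q j x)\<^sup>2) \<in> sos_upto d) \<and>
      (\<forall>i\<in>?I. s3 i \<in> sos_upto d) \<and> s4 \<in> sos_upto d \<and>
      (\<forall>i\<in>?I. (\<lambda>x. (g i x - P x) - s1 i x * ?h x
        - (\<Sum>j\<in>?I. (q j x)\<^sup>2 * (g i x - g j x))) \<in> sos_upto d) \<and>
      (\<forall>i\<in>?I. (\<lambda>x. J x - g i x - s3 i x * ?h x) \<in> sos_upto d) \<and>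
      (\<lambda>x. \<epsilon> - (J x - P x) - s4 x * ?h x) \<in> sos_upto d"
    using s1 s3 s4 q(1) J(1) P(1) unfolding swap
    by (intro eventually_conj eventually_ball_finite ballI eventually_poly_upto eventually_sos_upto
        is_sos_square) simp_all
  then have "\<forall>\<^sub>F d in sequentially. feasible_I d r m g J P \<epsilon>"
    by (rule eventually_mono)
      (unfold feasible_I_def, elim conjE,
       intro conjI exI[of _ s1] exI[of _ "\<lambda>i j x. (q j x)\<^sup>2"] exI[of _ s3] exI[of _ s4])
  then show ?thesis by blast
qed

subsection \<open>Optimal solutions and Hausdorff convergence\<close>

lemma poly_upto_uminus:
  assumes "p \<in> poly_upto d"
  shows "(\<lambda>x. - p x) \<in> poly_upto d"
  using poly_upto_mult[OF poly_upto_const[of "- 1" 0] assms] by simp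

text \<open>Negation exchanges upper and lower bounds, so the multipliers \<open>s2\<close>,
  \<open>s3\<close>, \<open>s1\<close> of the union problem take the roles of \<open>s1\<close>,
  \<open>s2\<close>, \<open>s3\<close>.\<close>

lemma feasible_U_imp_feasible_I:
  assumes "feasible_U d r m g J P \<gamma>"
  shows "feasible_I d r m (\<lambda>i x. - g i x) (\<lambda>x. - P x) (\<lambda>x. - J x) \<gamma>"
proof -
  obtain s1 s2 s3 s4 where
    "J \<in> poly_upto d" "P \<in> poly_upto d"
    "\<forall>i\<in>{1..m}. s1 i \<in> sos_upto d" "\<forall>i\<in>{1..m}. s2 i \<in> sos_upto d"
    "\<forall>i\<in>{1..m}. \<forall>j\<in>{1..m}. s3 i j \<in> sos_upto d" "s4 \<in> sos_upto d"
    "\<forall>i\<in>{1..m}. (\<lambda>x. (g i x - P x) - s1 i x * (r\<^sup>2 - (norm x)\<^sup>2)) \<in> sos_upto d"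
    "\<forall>i\<in>{1..m}. (\<lambda>x. (J x - g i x) - s2 i x * (r\<^sup>2 - (norm x)\<^sup>2)
        - (\<Sum>j=1..m. s3 i j x * (g j x - g i x))) \<in> sos_upto d"
    "(\<lambda>x. \<gamma> - (J x - P x) - s4 x * (r\<^sup>2 - (norm x)\<^sup>2)) \<in> sos_upto d"
    using assms unfolding feasible_U_def by (elim conjE exE) (rule that)
  then show ?thesis
    unfolding feasible_I_def
    by (intro conjI poly_upto_uminus exI[of _ s2] exI[of _ s3] exI[of _ s1] exI[of _ s4])
      (simp_all only: minus_diff_minus minus_diff_commute diff_minus_eq_add uminus_add_conv_diff)
qed

text \<open>Optimality needs this direction: every competitor in the negated problem must come from
  one with the same \<open>\<gamma>\<close> in the original.\<close>

lemma feasible_I_imp_feasible_U: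
  assumes "feasible_I d r m (\<lambda>i x. - g i x) J P \<gamma>"
  shows "feasible_U d r m g (\<lambda>x. - P x) (\<lambda>x. - J x) \<gamma>"
proof -
  obtain s1 s2 s3 s4 where cert:
    "J \<in> poly_upto d" "P \<in> poly_upto d"
    "\<forall>i\<in>{1..m}. s1 i \<in> sos_upto d" "\<forall>i\<in>{1..m}. \<forall>j\<in>{1..m}. s2 i j \<in> sos_upto d"
    "\<forall>i\<in>{1..m}. s3 i \<in> sos_upto d" "s4 \<in> sos_upto d"
    "\<forall>i\<in>{1..m}. (\<lambda>x. (- g i x - P x) - s1 i x * (r\<^sup>2 - (norm x)\<^sup>2)
        - (\<Sum>j=1..m. s2 i j x * (- g i x - - g j x))) \<in> sos_upto d"
    "\<forall>i\<in>{1..m}. (\<lambda>x. J x - - g i x - s3 i x * (r\<^sup>2 - (norm x)\<^sup>2)) \<in> sos_upto d"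
    "(\<lambda>x. \<gamma> - (J x - P x) - s4 x * (r\<^sup>2 - (norm x)\<^sup>2)) \<in> sos_upto d"
    using assms unfolding feasible_I_def by (elim conjE exE) (rule that)
  have neg: "- P x - g i x = - g i x - P x" for i x by simp
  show ?thesis
    using cert unfolding feasible_U_def
    by (intro conjI poly_upto_uminus exI[of _ s3] exI[of _ s1] exI[of _ s2] exI[of _ s4])
      (simp_all add: add.commute neg)
qed

lemma optimal_U_imp_optimal_I:
  assumes "optimal_U d r m g J P \<gamma>"
  shows "optimal_I d r m (\<lambda>i x. - g i x) (\<lambda>x. - P x) (\<lambda>x. - J x) \<gamma>"
  using assms feasible_U_imp_feasible_I feasible_I_imp_feasible_U
  unfolding optimal_U_def optimal_I_def by blast

text \<open>Without constraints the lower bound \<open>P\<close> can be raised indefinitely.\<close>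

lemma optimal_I_pos:
  assumes "optimal_I d r m g J P \<gamma>"
  shows "0 < m"
proof (rule ccontr)
  assume "\<not> 0 < m"
  then have m: "m = 0" by simp
  obtain s4 where JP: "J \<in> poly_upto d" "P \<in> poly_upto d" and "s4 \<in> sos_upto d"
    and "(\<lambda>x. \<gamma> - (J x - P x) - s4 x * (r\<^sup>2 - (norm x)\<^sup>2)) \<in> sos_upto d"
    using assms unfolding optimal_I_def feasible_I_def by blast
  moreover have "(\<lambda>x. \<gamma> - 1 - (J x - (P x + 1)) - s4 x * (r\<^sup>2 - (norm x)\<^sup>2)) =
      (\<lambda>x. \<gamma> - (J x - P x) - s4 x * (r\<^sup>2 - (norm x)\<^sup>2))"
    by (intro ext) simp
  ultimately have "feasible_I d r m g J (\<lambda>x. P x + 1) (\<gamma> - 1)"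
    unfolding feasible_I_def m using poly_upto_add[OF JP(2) poly_upto_const]
    by (intro conjI exI[of _ s4] exI) auto
  then show False
    using assms unfolding optimal_I_def by force
qed

section \<open>Pointwise consequences of feasibility\<close>

lemma sos_upto_nonneg: "p \<in> sos_upto d \<Longrightarrow> 0 \<le> p x"
  by (simp add: sos_upto_def is_sos_nonneg)

lemma sos_upto_mult_nonneg: "p \<in> sos_upto d \<Longrightarrow> 0 \<le> c \<Longrightarrow> 0 \<le> p x * c"
  by (simp add: sos_upto_nonneg)

lemma feasible_I_bounds:
  assumes "feasible_I d r m g J P \<gamma>" and x: "norm x \<le> r"
  shows "\<forall>i\<in>{1..m}. g i x \<le> J x"
    and "0 < m \<Longrightarrow> \<exists>i\<in>{1..m}. P x \<le> g i x"
    and "J x - P x \<le> \<gamma>"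
proof -
  let ?h = "\<lambda>x :: real ^ 'n. r\<^sup>2 - (norm x)\<^sup>2"
  have h: "0 \<le> ?h x" using x by (simp add: power_mono)
  obtain s1 s2 s3 s4 where sos: "\<forall>i\<in>{1..m}. s1 i \<in> sos_upto d"
    "\<forall>i\<in>{1..m}. \<forall>j\<in>{1..m}. s2 i j \<in> sos_upto d"
    "\<forall>i\<in>{1..m}. s3 i \<in> sos_upto d" "s4 \<in> sos_upto d"
    and lower: "\<forall>i\<in>{1..m}. (\<lambda>x. (g i x - P x) - s1 i x * ?h x
                - (\<Sum>j=1..m. s2 i j x * (g i x - g j x))) \<in> sos_upto d"
    and upper: "\<forall>i\<in>{1..m}. (\<lambda>x. J x - g i x - s3 i x * ?h x) \<in> sos_upto d"
    and gap: "(\<lambda>x. \<gamma> - (J x - P x) - s4 x * ?h x) \<in> sos_upto d"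
    using assms(1) unfolding feasible_I_def by (elim conjE exE) (rule that)
  show "\<forall>i\<in>{1..m}. g i x \<le> J x"
  proof
    fix i assume i: "i \<in> {1..m}"
    have "0 \<le> s3 i x * ?h x"
      by (rule sos_upto_mult_nonneg[OF bspec[OF sos(3) i] h])
    then show "g i x \<le> J x"
      using sos_upto_nonneg[OF bspec[OF upper i], of x] by linarith
  qed
  have "0 \<le> s4 x * ?h x"
    by (rule sos_upto_mult_nonneg[OF sos(4) h])
  then show "J x - P x \<le> \<gamma>"
    using sos_upto_nonneg[OF gap, of x] by linarith
  show "\<exists>i\<in>{1..m}. P x \<le> g i x" if "0 < m"
  proof -
    \<comment> \<open>At an index maximising \<open>g i x\<close> all coupling terms
      \<open>s2 i j x * (g i x - g j x)\<close> are nonnegative, so that constraint forces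
      \<open>P x \<le> g i x\<close>.\<close>
    have "Max ((\<lambda>i. g i x) ` {1..m}) \<in> (\<lambda>i. g i x) ` {1..m}"
      using that by (intro Max_in) auto
    then obtain i where i: "i \<in> {1..m}" and max: "Max ((\<lambda>i. g i x) ` {1..m}) = g i x"
      by (rule imageE)
    have le: "g j x \<le> g i x" if "j \<in> {1..m}" for j
      unfolding max[symmetric] using that by (intro Max_ge) auto
    have "0 \<le> s1 i x * ?h x"
      by (rule sos_upto_mult_nonneg[OF bspec[OF sos(1) i] h])
    moreover have "0 \<le> (\<Sum>j=1..m. s2 i j x * (g i x - g j x))"
    proof (rule sum_nonneg)
      fix j assume j: "j \<in> {1..m}"
      then show "0 \<le> s2 i j x * (g i x - g j x)"
        using sos_upto_mult_nonneg[OF bspec[OF bspec[OF sos(2) i] j]] le[OF j] by simp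
    qed
    ultimately have "P x \<le> g i x"
      using sos_upto_nonneg[OF bspec[OF lower i], of x] by linarith
    then show ?thesis using i by blast
  qed
qed

section \<open>Hausdorff convergence from pointwise membership\<close>

lemma hausdorff_excess_subset:
  assumes "A \<subseteq> B"
  shows "hausdorff_excess A B = 0"
proof -
  have "(INF y\<in>B. ennreal (norm (x - y))) = 0" if "x \<in> A" for x
    using INF_lower[of x B "\<lambda>y. ennreal (norm (x - y))"] assms that by auto
  then show ?thesis
    unfolding hausdorff_excess_def by (cases "A = {}") (auto simp: bot_ennreal)
qed

text \<open>Inclusion makes one excess zero. For the other, a finite \<open>e\<close>-net of
  \<open>X\<close> with centres in \<open>X\<close> eventually lies in \<open>S d\<close>, which
  gives uniformity in the points of \<open>X\<close>.\<close>

lemma hausdorff_distance_tendsto_0: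
  assumes "bounded X" and sub: "\<forall>\<^sub>F d in F. S d \<subseteq> X"
    and ev: "\<And>x. x \<in> X \<Longrightarrow> \<forall>\<^sub>F d in F. x \<in> S d"
  shows "((\<lambda>d. hausdorff_distance (S d) X) \<longlongrightarrow> 0) F"
proof -
  have "\<forall>\<^sub>F d in F. hausdorff_distance (S d) X \<le> ennreal e" if "0 < e" for e
  proof -
    \<comment> \<open>\<open>X\<close> may fail to be closed, so its compact closure is covered,
      still by balls centred in \<open>X\<close>.\<close>
    have "compact (closure X)" "closure X \<subseteq> (\<Union>c\<in>X. ball c e)"
      using assms(1) that by (auto simp: compact_closure closure_approachable)
    then obtain C where "C \<subseteq> X" "finite C" "closure X \<subseteq> (\<Union>c\<in>C. ball c e)"
      using compactE_image[of "closure X" X "\<lambda>c. ball c e"] open_ball by metis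
    then have C: "finite C" "C \<subseteq> X" "X \<subseteq> (\<Union>c\<in>C. ball c e)"
      using closure_subset[of X] by (simp_all only: order_trans)
    have "\<forall>\<^sub>F d in F. \<forall>c\<in>C. c \<in> S d"
      using C(1,2) ev by (intro eventually_ball_finite) auto
    then show ?thesis using sub
    proof eventually_elim
      case (elim d)
      have "hausdorff_excess X (S d) \<le> ennreal e"
        unfolding hausdorff_excess_def
      proof (rule SUP_least)
        fix x assume "x \<in> X"
        then obtain c where c: "c \<in> C" "dist c x < e" using C(3) by auto
        have "(INF y\<in>S d. ennreal (norm (x - y))) \<le> ennreal (norm (x - c))"
          using elim(1) c(1) by (intro INF_lower) auto
        also have "\<dots> \<le> ennreal e"
          using c(2) by (intro ennreal_leI) (simp add: dist_norm norm_minus_commute)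
        finally show "(INF y\<in>S d. ennreal (norm (x - y))) \<le> ennreal e" .
      qed
      then show ?case
        unfolding hausdorff_distance_def using hausdorff_excess_subset[OF elim(2)] by simp
    qed
  qed
  then have "\<forall>\<^sub>F d in F. hausdorff_distance (S d) X < a" if a: "0 < a" for a
  proof -
    \<comment> \<open>The level \<open>a\<close> may be infinite; a smaller positive
      \<open>y\<close> is finite and corresponds to a real radius.\<close>
    obtain y where y: "0 < y" "y < a" using dense[OF a] by blast
    then have "y < top" using top.not_eq_extremum by fastforce
    then have "0 < enn2real y" "ennreal (enn2real y) = y"
      using y(1) by (simp_all add: enn2real_positive_iff)
    then show ?thesis
      using \<open>\<And>e. 0 < e \<Longrightarrow> \<forall>\<^sub>F d in F. hausdorff_distance (S d) X \<le> ennreal e\<close>[of "enn2real y"] y(2)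
      by (auto elim!: eventually_mono)
  qed
  then show ?thesis
    by (intro order_tendstoI) auto
qed

lemma sublevel_hausdorff_limit:
  assumes "bounded X" and "\<And>d. d0 \<le> d \<Longrightarrow> S d \<subseteq> X"
    and "\<And>x. x \<in> X \<Longrightarrow> \<forall>\<^sub>F d in sequentially. x \<in> S d"
  shows "(\<lambda>d. hausdorff_distance (S d) X) \<longlonglongrightarrow> 0 \<and> (\<forall>d\<ge>d0. S d \<subseteq> X)"
  using assms(2) hausdorff_distance_tendsto_0[OF assms(1) eventually_sequentiallyI[of d0] assms(3)]
  by blast

text \<open>A competitor with value \<open>\<epsilon>\<close> is feasible for all large
  \<open>d\<close>, so the optimal value cannot exceed \<open>\<epsilon>\<close>.\<close>

lemma optimal_I_gap:
  assumes "r > 0" "\<And>i. i \<in> {1..m} \<Longrightarrow> real_polynomial_function (g i)"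
    and opt: "\<And>d. d0 \<le> d \<Longrightarrow> optimal_I d r m g (J d) (P d) (\<gamma> d)" and "0 < \<epsilon>"
  shows "\<forall>\<^sub>F d in sequentially. \<gamma> d \<le> \<epsilon>"
proof -
  have "0 < m" using opt[of d0] optimal_I_pos by blast
  then obtain J' P' where "\<forall>\<^sub>F d in sequentially. feasible_I d r m g J' P' \<epsilon>"
    using ex_feasible_I[of r m g \<epsilon>] assms by blast
  then show ?thesis
    using eventually_ge_at_top[of d0]
    by eventually_elim (use opt in \<open>auto simp: optimal_I_def\<close>)
qed

text \<open>Taking \<open>d0 = 0\<close> gives the version in which every degree has an optimal
  solution; a larger \<open>d0\<close> covers solvability from some degree on.\<close>

theorem theorem3:
  fixes r :: real and m d0 :: nat
    and g J :: "nat \<Rightarrow> real ^ 'n::finite \<Rightarrow> real"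
    and X :: "(real ^ 'n) set"
  assumes "r > 0"
    and "\<forall>i\<in>{1..m}. real_polynomial_function (g i)"
    and "\<forall>d. real_polynomial_function (J d)"
    and "(X = {x. norm x \<le> r \<and> (\<forall>i\<in>{1..m}. g i x < 0)} \<and>
            (\<forall>d\<ge>d0. \<exists>P \<gamma>. optimal_I d r m g (J d) P \<gamma>)) \<or>
         (X = (\<Union>i\<in>{1..m}. {x. norm x \<le> r \<and> g i x < 0}) \<and>
            (\<forall>d\<ge>d0. \<exists>P \<gamma>. optimal_U d r m g (J d) P \<gamma>))"
  shows "((\<lambda>d. hausdorff_distance {x. norm x \<le> r \<and> J d x < 0} X) \<longlonglongrightarrow> 0) \<and>
         (\<forall>d\<ge>d0. {x. norm x \<le> r \<and> J d x < 0} \<subseteq> X)"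
proof -
  have g: "real_polynomial_function (g i)" if "i \<in> {1..m}" for i
    using assms(2) that by blast
  have ball: "bounded {x :: real ^ 'n. norm x \<le> r}"
    by (auto simp: bounded_iff)
  show ?thesis
    using assms(4)
  proof (elim disjE conjE)
    assume X: "X = {x. norm x \<le> r \<and> (\<forall>i\<in>{1..m}. g i x < 0)}"
      and "\<forall>d\<ge>d0. \<exists>P \<gamma>. optimal_I d r m g (J d) P \<gamma>"
    then obtain P \<gamma> where opt: "\<And>d. d0 \<le> d \<Longrightarrow> optimal_I d r m g (J d) (P d) (\<gamma> d)"
      by metis
    then have feas: "feasible_I d r m g (J d) (P d) (\<gamma> d)" if "d0 \<le> d" for d
      using that by (simp add: optimal_I_def)
    have m: "0 < m" using opt[of d0] optimal_I_pos by blast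
    show ?thesis
    proof (rule sublevel_hausdorff_limit)
      show "bounded X" using X by (intro bounded_subset[OF ball]) auto
      show "{x. norm x \<le> r \<and> J d x < 0} \<subseteq> X" if "d0 \<le> d" for d
        unfolding X using feasible_I_bounds(1)[OF feas[OF that]] by fastforce
      fix x assume x: "x \<in> X"
      \<comment> \<open>The margin by which every \<open>g i\<close> is negative at
        \<open>x\<close>. Once \<open>\<gamma> d \<le> c / 2\<close>, some \<open>i\<close> gives
        \<open>J d x \<le> P d x + \<gamma> d \<le> g i x + c / 2 < 0\<close>.\<close>
      define c where "c = Min ((\<lambda>i. - g i x) ` {1..m})"
      have "0 < c" unfolding c_def using x m by (subst Min_gr_iff) (auto simp: X)
      have c: "g i x \<le> - c" if "i \<in> {1..m}" for i
      proof -
        have "c \<le> - g i x" unfolding c_def using that by (intro Min_le) auto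
        then show ?thesis by linarith
      qed
      have "\<forall>\<^sub>F d in sequentially. \<gamma> d \<le> c / 2"
        using \<open>0 < c\<close> by (intro optimal_I_gap[OF assms(1) g opt]) auto
      then show "\<forall>\<^sub>F d in sequentially. x \<in> {x. norm x \<le> r \<and> J d x < 0}"
        using eventually_ge_at_top[of d0]
      proof eventually_elim
        case (elim d)
        have nx: "norm x \<le> r" using x X by simp
        obtain i where "i \<in> {1..m}" "P d x \<le> g i x"
          using feasible_I_bounds(2)[OF feas[OF elim(2)] nx m] by blast
        then have "J d x < 0"
          using c[of i] feasible_I_bounds(3)[OF feas[OF elim(2)] nx] elim(1) \<open>0 < c\<close> by linarith
        then show ?case using nx by simp
      qed
    qed
  next
    assume X: "X = (\<Union>i\<in>{1..m}. {x. norm x \<le> r \<and> g i x < 0})"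
      and "\<forall>d\<ge>d0. \<exists>P \<gamma>. optimal_U d r m g (J d) P \<gamma>"
    then obtain P \<gamma> where "\<And>d. d0 \<le> d \<Longrightarrow> optimal_U d r m g (J d) (P d) (\<gamma> d)"
      by metis
    then have opt: "optimal_I d r m (\<lambda>i x. - g i x) (\<lambda>x. - P d x) (\<lambda>x. - J d x) (\<gamma> d)"
      if "d0 \<le> d" for d
      using that optimal_U_imp_optimal_I by blast
    then have feas: "feasible_I d r m (\<lambda>i x. - g i x) (\<lambda>x. - P d x) (\<lambda>x. - J d x) (\<gamma> d)"
      if "d0 \<le> d" for d
      using that by (simp add: optimal_I_def)
    have m: "0 < m" using opt[of d0] optimal_I_pos by blast
    show ?thesis
    proof (rule sublevel_hausdorff_limit)
      show "bounded X" using X by (intro bounded_subset[OF ball]) auto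
      \<comment> \<open>In the negated problem the bound attained at some index reads
        \<open>g i x \<le> J d x\<close>, which places \<open>x\<close> in one member of the
        union.\<close>
      show "{x. norm x \<le> r \<and> J d x < 0} \<subseteq> X" if "d0 \<le> d" for d
        unfolding X using feasible_I_bounds(2)[OF feas[OF that] _ m] by fastforce
      fix x assume "x \<in> X"
      then obtain i where i: "i \<in> {1..m}" "norm x \<le> r" "g i x < 0"
        unfolding X by blast
      \<comment> \<open>Here \<open>P d\<close> lies below every \<open>g i\<close>, so one negative
        \<open>g i x\<close> suffices:
        \<open>J d x \<le> P d x + \<gamma> d \<le> g i x / 2 < 0\<close>.\<close>
      have "\<forall>\<^sub>F d in sequentially. \<gamma> d \<le> - g i x / 2"
        using i(3) g by (intro optimal_I_gap[OF assms(1) _ opt]) auto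
      then show "\<forall>\<^sub>F d in sequentially. x \<in> {x. norm x \<le> r \<and> J d x < 0}"
        using eventually_ge_at_top[of d0]
      proof eventually_elim
        case (elim d)
        have "- g i x \<le> - P d x"
          using feasible_I_bounds(1)[OF feas[OF elim(2)] i(2)] i(1) by blast
        then have "J d x < 0"
          using feasible_I_bounds(3)[OF feas[OF elim(2)] i(2)] elim(1) i(3) by linarith
        then show ?case using i(2) by simp
      qed
    qed
  qed
qed

end
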